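(* Let $f\in\mathbb{C}[h]$. The generalized Heisenberg algebra $\mathcal{H}(f)$ is right Noetherian if and only if $\deg f=1$; likewise, $\mathcal{H}(f)$ is left Noetherian if and only if $\deg f=1$.
   Context: For a polynomial $f\in\mathbb{C}[h]$, the generalized Heisenberg algebra $\mathcal{H}(f)$ is the unital associative $\mathbb{C}$-algebra with generators $x,y,h$ and defining relations $$hx=xf(h),\qquad yh=f(h)y,\qquad yx-xy=f(h)-h.$$ Here $\deg f$ is the degree of $f$ as a polynomial in $h$; constant polynomials (including the zero polynomial) are regarded as having degree $0$. *)

theory Defs
  imports
    Complex_Main
    "HOL-Library.Poly_Mapping"
    "HOL-Computational_Algebra.Polynomial"
    "HOL-Algebra.QuotRing"
begin

section \<open>One-sided ideals and one-sided Noetherian rings\<close>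

text \<open>The locales \<open>ideal\<close> and \<open>noetherian_ring\<close> of HOL-Algebra are about two-sided ideals;
  these are their one-sided analogues, for rings that need not be commutative.\<close>

locale left_ideal = additive_subgroup I R + ring R for I and R (structure) +
  assumes I_l_closed: "\<lbrakk>a \<in> I; x \<in> carrier R\<rbrakk> \<Longrightarrow> x \<otimes> a \<in> I"

locale right_ideal = additive_subgroup I R + ring R for I and R (structure) +
  assumes I_r_closed: "\<lbrakk>a \<in> I; x \<in> carrier R\<rbrakk> \<Longrightarrow> a \<otimes> x \<in> I"

definition gen_left_ideal :: "('a, 'b) ring_scheme \<Rightarrow> 'a set \<Rightarrow> 'a set"
  where "gen_left_ideal R S = \<Inter>{I. left_ideal I R \<and> S \<subseteq> I}"

definition gen_right_ideal :: "('a, 'b) ring_scheme \<Rightarrow> 'a set \<Rightarrow> 'a set"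
  where "gen_right_ideal R S = \<Inter>{I. right_ideal I R \<and> S \<subseteq> I}"

locale left_noetherian_ring = ring +
  assumes left_finitely_gen:
    "left_ideal I R \<Longrightarrow> \<exists>A \<subseteq> carrier R. finite A \<and> I = gen_left_ideal R A"

locale right_noetherian_ring = ring +
  assumes right_finitely_gen:
    "right_ideal I R \<Longrightarrow> \<exists>A \<subseteq> carrier R. finite A \<and> I = gen_right_ideal R A"


section \<open>The free algebra on three generators\<close>

datatype gen = Gen_x | Gen_y | Gen_h

text \<open>The free monoid on the generators. It is written additively because the convolution
  product on \<open>Poly_Mapping\<close> expects the monoid of exponents in this form.\<close>

datatype word = Word (letters: "gen list")

instantiation word :: monoid_add
begin

definition zero_word :: word
  where "0 = Word []"

definition plus_word :: "word \<Rightarrow> word \<Rightarrow> word"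
  where "u + v = Word (letters u @ letters v)"

instance
  by standard (simp_all add: zero_word_def plus_word_def)

end

text \<open>Finitely supported functions on words, with the convolution product: the monoid algebra
  of the free monoid, i.e. the free unital associative complex algebra on \<open>gen\<close>.\<close>

type_synonym free_alg = "word \<Rightarrow>\<^sub>0 complex"

definition var :: "gen \<Rightarrow> free_alg"
  where "var g = Poly_Mapping.single (Word [g]) 1"

definition scalar :: "complex \<Rightarrow> free_alg"
  where "scalar c = Poly_Mapping.single 0 c"

text \<open>\<open>f(h)\<close> for a polynomial \<open>f\<close>; the library function \<open>poly\<close> needs a commutative ring.\<close>

definition poly_h :: "complex poly \<Rightarrow> free_alg"
  where "poly_h f = (\<Sum>i\<le>Polynomial.degree f. scalar (Polynomial.coeff f i) * var Gen_h ^ i)"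

definition free_alg_ring :: "free_alg ring"
  where "free_alg_ring = \<lparr>carrier = UNIV, mult = (*), one = 1, zero = 0, add = (+)\<rparr>"

lemma ring_free_alg_ring: "ring free_alg_ring"
proof (rule ringI)
  show "abelian_group free_alg_ring"
  proof (rule abelian_groupI)
    fix a assume "a \<in> carrier free_alg_ring"
    show "\<exists>b\<in>carrier free_alg_ring. b \<oplus>\<^bsub>free_alg_ring\<^esub> a = \<zero>\<^bsub>free_alg_ring\<^esub>"
      by (rule bexI[of _ "- a"]) (simp_all add: free_alg_ring_def)
  qed (simp_all add: free_alg_ring_def algebra_simps)
  show "Group.monoid free_alg_ring"
    by (rule monoidI) (simp_all add: free_alg_ring_def mult.assoc)
qed (simp_all add: free_alg_ring_def algebra_simps)

lemma scalar_central: "scalar c * a = a * scalar c"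
proof (induction a rule: update_induct)
  case (update a k b)
  have "Poly_Mapping.update k b a = a + Poly_Mapping.single k b"
    using update.hyps
    by (intro poly_mapping_eqI) (auto simp: lookup_update lookup_add lookup_single when_def
        in_keys_iff)
  then show ?case
    using update.IH by (simp add: scalar_def mult_single distrib_left distrib_right mult.commute)
qed simp_all


section \<open>Generalized Heisenberg algebras\<close>

text \<open>The defining relations \<open>l = r\<close>, as elements \<open>l - r\<close> of the free algebra.\<close>

definition heisenberg_relations :: "complex poly \<Rightarrow> free_alg set"
  where "heisenberg_relations f =
    {var Gen_h * var Gen_x - var Gen_x * poly_h f,
     var Gen_y * var Gen_h - poly_h f * var Gen_y,
     (var Gen_y * var Gen_x - var Gen_x * var Gen_y) - (poly_h f - var Gen_h)}"

text \<open>Since the free algebra contains the scalars, the two-sided ring ideal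
  generated by the relations is closed under scalar multiplication, so this quotient of rings is
  the underlying ring of the algebra with the given presentation. For the same reason its
  one-sided ideals as a ring and as a complex algebra agree.\<close>

definition gen_heisenberg_algebra :: "complex poly \<Rightarrow> free_alg set ring"
  where "gen_heisenberg_algebra f =
    free_alg_ring Quot (Idl\<^bsub>free_alg_ring\<^esub> (heisenberg_relations f))"

end

theory Submission
  imports
    Defs
    "HOL-Library.Function_Algebras"
    "HOL-Computational_Algebra.Fundamental_Theorem_Algebra"
begin

text \<open>If \<open>f = a h + b\<close> with \<open>a \<noteq> 0\<close>, then \<open>\<H>(f)\<close> is obtained from \<open>\<complex>\<close> by adjoining \<open>h\<close>, \<open>x\<close>, \<open>y\<close>
  one after the other, and each new generator \<open>v\<close> satisfies \<open>v A + A = A v + A\<close> for the subring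
  \<open>A\<close> reached before it; Hilbert's basis theorem holds for such extensions.

  Otherwise \<open>f - h\<close> is not constant, so \<open>f\<close> has a fixed point \<open>c\<close>, and
  \<open>h - c\<close> divides \<open>f - c\<close> with a quotient that is not a unit. Since \<open>(h - c) x = x (f - c)\<close>, the
  right ideals generated by \<open>x\<^sup>m (h - c)\<close> for \<open>m \<le> n\<close> then increase strictly with \<open>n\<close>, as a right
  module on the space with basis \<open>x\<^sup>i h\<^sup>j y\<^sup>k\<close> shows.

  The anti-automorphism exchanging \<open>x\<close> and \<open>y\<close> transfers everything to left ideals.\<close>


section \<open>A Hilbert basis theorem for skew extensions\<close>

text \<open>A predicate on sets, so that \<open>unital_subring hull X\<close> is the subring
  generated by \<open>X\<close> and all subrings share the operations of one ambient ring.\<close>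

definition unital_subring :: "'a::ring_1 set \<Rightarrow> bool"
  where "unital_subring A \<longleftrightarrow> 1 \<in> A \<and> (\<forall>a\<in>A. \<forall>b\<in>A. a - b \<in> A \<and> a * b \<in> A)"

lemma unital_subringI:
  assumes "1 \<in> A" "\<And>a b. a \<in> A \<Longrightarrow> b \<in> A \<Longrightarrow> a - b \<in> A" "\<And>a b. a \<in> A \<Longrightarrow> b \<in> A \<Longrightarrow> a * b \<in> A"
  shows "unital_subring A"
  using assms by (auto simp: unital_subring_def)

lemma unital_subring_closed:
  assumes "unital_subring A"
  shows "1 \<in> A" and "0 \<in> A" and "a \<in> A \<Longrightarrow> - a \<in> A" and "a \<in> A \<Longrightarrow> b \<in> A \<Longrightarrow> a + b \<in> A"
    and "a \<in> A \<Longrightarrow> b \<in> A \<Longrightarrow> a - b \<in> A" and "a \<in> A \<Longrightarrow> b \<in> A \<Longrightarrow> a * b \<in> A"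
proof -
  show one: "1 \<in> A" and diff: "\<And>a b. a \<in> A \<Longrightarrow> b \<in> A \<Longrightarrow> a - b \<in> A"
    and "a \<in> A \<Longrightarrow> b \<in> A \<Longrightarrow> a * b \<in> A"
    using assms by (auto simp: unital_subring_def)
  show zero: "0 \<in> A" using diff[OF one one] by simp
  show neg: "- a \<in> A" if "a \<in> A" for a using diff[OF zero that] by simp
  show "a + b \<in> A" if "a \<in> A" "b \<in> A" using diff[OF that(1) neg[OF that(2)]] by simp
qed

lemma unital_subring_hull: "unital_subring (unital_subring hull X)"
  by (rule hull_in) (auto simp: unital_subring_def)

definition right_ideal_in :: "'a::ring_1 set \<Rightarrow> 'a set \<Rightarrow> bool"
  where "right_ideal_in A J \<longleftrightarrow>
    J \<subseteq> A \<and> 0 \<in> J \<and> (\<forall>a\<in>J. \<forall>b\<in>J. a - b \<in> J) \<and> (\<forall>a\<in>J. \<forall>b\<in>A. a * b \<in> J)"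

lemma right_ideal_inD:
  assumes "right_ideal_in A J"
  shows "J \<subseteq> A" and "0 \<in> J" and "a \<in> J \<Longrightarrow> - a \<in> J" and "a \<in> J \<Longrightarrow> b \<in> J \<Longrightarrow> a + b \<in> J"
    and "a \<in> J \<Longrightarrow> b \<in> J \<Longrightarrow> a - b \<in> J" and "a \<in> J \<Longrightarrow> b \<in> A \<Longrightarrow> a * b \<in> J"
proof -
  show "J \<subseteq> A" and zero: "0 \<in> J" and diff: "\<And>a b. a \<in> J \<Longrightarrow> b \<in> J \<Longrightarrow> a - b \<in> J"
    and "a \<in> J \<Longrightarrow> b \<in> A \<Longrightarrow> a * b \<in> J"
    using assms by (auto simp: right_ideal_in_def)
  show neg: "- a \<in> J" if "a \<in> J" for a using diff[OF zero that] by simp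
  show "a + b \<in> J" if "a \<in> J" "b \<in> J" using diff[OF that(1) neg[OF that(2)]] by simp
qed

text \<open>For an ideal \<open>I\<close> this says that \<open>A / I\<close> is right Noetherian; working relative to \<open>I\<close>
  keeps all computations in the ambient ring.\<close>

definition right_noetherian_over :: "'a::ring_1 set \<Rightarrow> 'a set \<Rightarrow> bool"
  where "right_noetherian_over I A \<longleftrightarrow>
    (\<forall>J. right_ideal_in A J \<and> I \<subseteq> J \<longrightarrow>
      (\<exists>G\<subseteq>J. finite G \<and> (\<forall>K. right_ideal_in A K \<and> I \<subseteq> K \<and> G \<subseteq> K \<longrightarrow> J \<subseteq> K)))"

lemma right_noetherian_overE:
  assumes "right_noetherian_over I A" "right_ideal_in A J" "I \<subseteq> J"
  obtains G where "G \<subseteq> J" "finite G"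
    "\<And>K. right_ideal_in A K \<Longrightarrow> I \<subseteq> K \<Longrightarrow> G \<subseteq> K \<Longrightarrow> J \<subseteq> K"
proof -
  have "\<exists>G\<subseteq>J. finite G \<and> (\<forall>K. right_ideal_in A K \<and> I \<subseteq> K \<and> G \<subseteq> K \<longrightarrow> J \<subseteq> K)"
    using assms by (simp add: right_noetherian_over_def)
  then show thesis using that by metis
qed

text \<open>A finite generating set of the union of an ascending chain already lies in one member.
  This serves the ideals of leading coefficients and, in the negative case, refutes finite
  generation.\<close>

lemma finite_subset_chain:
  fixes L :: "nat \<Rightarrow> 'a set"
  assumes "mono L" "finite G" "G \<subseteq> (\<Union>n. L n)"
  obtains N where "G \<subseteq> L N"
proof -
  have "\<exists>N. G \<subseteq> L N"
    using assms(2,3)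
  proof (induction G)
    case (insert g G)
    then obtain M N where "G \<subseteq> L M" "g \<in> L N" by auto
    moreover have "L M \<subseteq> L (max M N)" "L N \<subseteq> L (max M N)"
      by (auto intro!: monoD[OF \<open>mono L\<close>])
    ultimately have "insert g G \<subseteq> L (max M N)" by auto
    then show ?case by blast
  qed auto
  then show thesis using that by blast
qed

text \<open>The elements \<open>b\<close> and \<open>c\<close> may be non-unique and the powers of
  \<open>x\<close> dependent over \<open>A\<close>, so quotients of Ore extensions are covered.
  \<open>var_mult\<close> moves \<open>x\<close> to the right of coefficients;
  \<open>mult_var\<close> makes leading coefficients closed under right multiplication by
  \<open>A\<close>.\<close>

locale skew_extension =
  fixes A :: "'a::ring_1 set" and x :: 'a
  assumes subring: "unital_subring A"
    and var_mult: "a \<in> A \<Longrightarrow> \<exists>b\<in>A. \<exists>c\<in>A. x * a = b * x + c"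
    and mult_var: "a \<in> A \<Longrightarrow> \<exists>b\<in>A. \<exists>c\<in>A. a * x = x * b + c"
begin

section \<open>Sums of bounded degree in the new variable\<close>

lemmas A_closed = unital_subring_closed[OF subring]

text \<open>The degree bound is strict, so the remainder after a top term \<open>a * x ^ n\<close>
  lies in \<open>below n\<close>. Expansions can be non-unique, hence a filtration by sets instead
  of a degree function.\<close>

primrec below :: "nat \<Rightarrow> 'a set"
  where "below 0 = {0}"
  | "below (Suc n) = {a * x ^ n + l | a l. a \<in> A \<and> l \<in> below n}"

definition ext :: "'a set"
  where "ext = (\<Union>n. below n)"

lemma below_SucI: "a \<in> A \<Longrightarrow> l \<in> below n \<Longrightarrow> a * x ^ n + l \<in> below (Suc n)"
  by auto

lemma monom_below: "a \<in> A \<Longrightarrow> a * x ^ n \<in> below (Suc n)"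
proof (induction n)
  case 0
  show ?case using below_SucI[OF 0, of 0 0] by simp
next
  case (Suc n)
  have "0 \<in> below k" for k
    by (induction k) (use A_closed(2) in force)+
  from below_SucI[OF Suc.prems this[of "Suc n"]] show ?case by simp
qed

lemma below_Suc: "l \<in> below n \<Longrightarrow> l \<in> below (Suc n)"
  using below_SucI[OF A_closed(2), of l n] by (simp del: below.simps)

lemma mono_below: "mono below"
  by (rule incseq_SucI) (rule subsetI, rule below_Suc)

lemma zero_below: "0 \<in> below n"
  using monoD[OF mono_below, of 0 n] by auto

lemma below_diff: "l \<in> below n \<Longrightarrow> m \<in> below n \<Longrightarrow> l - m \<in> below n"
proof (induction n arbitrary: l m)
  case (Suc n)
  then obtain a b l' m' where *: "l = a * x ^ n + l'" "m = b * x ^ n + m'" "a \<in> A" "b \<in> A"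
    "l' \<in> below n" "m' \<in> below n" by auto
  have eq: "l - m = (a - b) * x ^ n + (l' - m')" by (simp add: * algebra_simps)
  show ?case unfolding eq by (intro below_SucI A_closed Suc.IH *)
qed simp

lemma below_uminus: "l \<in> below n \<Longrightarrow> - l \<in> below n"
  using below_diff[OF zero_below, of l n] by (simp del: below.simps)

lemma below_add: "l \<in> below n \<Longrightarrow> m \<in> below n \<Longrightarrow> l + m \<in> below n"
  using below_diff[OF _ below_uminus, of l n m] by (simp del: below.simps)

lemma below_mult_var: "l \<in> below n \<Longrightarrow> l * x \<in> below (Suc n)"
proof (induction n arbitrary: l)
  case 0
  then show ?case using zero_below[of "Suc 0"] by simp
next
  case (Suc n)
  then obtain a l' where *: "l = a * x ^ n + l'" "a \<in> A" "l' \<in> below n" by auto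
  have "l * x = a * x ^ Suc n + l' * x" by (simp add: * algebra_simps power_commutes)
  then show ?case using * Suc.IH[of l'] by (metis below_SucI)
qed

lemma below_mult_power: "l \<in> below n \<Longrightarrow> l * x ^ k \<in> below (n + k)"
proof (induction k)
  case (Suc k)
  from below_mult_var[OF Suc.IH[OF Suc.prems]] show ?case
    by (simp add: mult.assoc power_commutes del: below.simps)
qed simp

lemma var_mult_below: "l \<in> below n \<Longrightarrow> x * l \<in> below (Suc n)"
proof (induction n arbitrary: l)
  case 0
  then show ?case using zero_below[of "Suc 0"] by simp
next
  case (Suc n)
  then obtain a l' where *: "l = a * x ^ n + l'" "a \<in> A" "l' \<in> below n" by auto
  obtain b c where bc: "b \<in> A" "c \<in> A" "x * a = b * x + c" using var_mult[OF *(2)] by blast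
  have "x * l = (x * a) * x ^ n + x * l'" by (simp add: * algebra_simps)
  also have "\<dots> = b * x ^ Suc n + (c * x ^ n + x * l')" by (simp add: bc algebra_simps)
  finally show ?case
    using below_SucI[OF bc(1) below_add[OF monom_below[OF bc(2)] Suc.IH[OF *(3)]]] by metis
qed

lemma power_mult: "a \<in> A \<Longrightarrow> \<exists>b\<in>A. \<exists>l\<in>below n. x ^ n * a = b * x ^ n + l"
proof (induction n)
  case (Suc n)
  then obtain b l where *: "b \<in> A" "l \<in> below n" "x ^ n * a = b * x ^ n + l" by blast
  obtain b' c where bc: "b' \<in> A" "c \<in> A" "x * b = b' * x + c" using var_mult[OF *(1)] by blast
  have "x ^ Suc n * a = (x * b) * x ^ n + x * l" by (simp add: * mult.assoc distrib_left)
  also have "\<dots> = b' * x ^ Suc n + (c * x ^ n + x * l)" by (simp add: bc algebra_simps)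
  finally show ?case
    using bc(1) below_add[OF monom_below[OF bc(2)] var_mult_below[OF *(2)]] by blast
qed auto

text \<open>Converse to \<open>power_mult\<close>: here the leading coefficient \<open>b\<close> is
  prescribed and the right factor \<open>c\<close> is found. Multiplying an element with top term
  \<open>a * x ^ n\<close> by this \<open>c\<close> turns the leading coefficient into
  \<open>a * b\<close>.\<close>

lemma mult_power: "b \<in> A \<Longrightarrow> \<exists>c\<in>A. \<exists>l\<in>below n. x ^ n * c = b * x ^ n + l"
proof (induction n)
  case (Suc n)
  then obtain c l where *: "c \<in> A" "l \<in> below n" "x ^ n * c = b * x ^ n + l" by blast
  obtain c' d where cd: "c' \<in> A" "d \<in> A" "c * x = x * c' + d" using mult_var[OF *(1)] by blast
  obtain e m where em: "e \<in> A" "m \<in> below n" "x ^ n * d = e * x ^ n + m"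
    using power_mult[OF cd(2)] by blast
  \<comment> \<open>Writing \<open>x * c'\<close> as \<open>c * x - d\<close> exposes
    \<open>x ^ n * c\<close>, which the induction hypothesis expands; the correction
    \<open>x ^ n * d\<close> has degree at most \<open>n\<close> and joins the remainder.\<close>
  have "x ^ Suc n * c' = x ^ n * (c * x - d)" by (simp add: cd power_Suc2 mult.assoc del: power_Suc)
  also have "\<dots> = (b * x ^ n + l) * x - x ^ n * d" by (simp add: right_diff_distrib mult.assoc flip: *(3))
  also have "\<dots> = b * x ^ Suc n + (l * x - (e * x ^ n + m))"
    by (simp add: em algebra_simps power_commutes)
  finally show ?case
    using cd(1) below_diff[OF below_mult_var[OF *(2)] below_SucI[OF em(1,2)]] by blast
qed auto

lemma mult_below: "a \<in> A \<Longrightarrow> l \<in> below n \<Longrightarrow> a * l \<in> below n"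
proof (induction n arbitrary: l)
  case (Suc n)
  then obtain b l' where *: "l = b * x ^ n + l'" "b \<in> A" "l' \<in> below n" by auto
  have eq: "a * l = (a * b) * x ^ n + a * l'" by (simp add: * algebra_simps)
  show ?case unfolding eq by (intro below_SucI A_closed Suc.IH * Suc.prems(1))
qed simp

lemma below_mult: "l \<in> below n \<Longrightarrow> a \<in> A \<Longrightarrow> l * a \<in> below n"
proof (induction n arbitrary: l)
  case (Suc n)
  then obtain b l' where *: "l = b * x ^ n + l'" "b \<in> A" "l' \<in> below n" by auto
  obtain c m where cm: "c \<in> A" "m \<in> below n" "x ^ n * a = c * x ^ n + m"
    using power_mult[OF Suc.prems(2)] by blast
  have "l * a = b * (x ^ n * a) + l' * a" by (simp add: * algebra_simps)
  also have "\<dots> = (b * c) * x ^ n + (b * m + l' * a)" by (simp add: cm algebra_simps)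
  finally show ?case
    using * cm Suc.IH[of l'] Suc.prems A_closed(6)[of b c] by (metis below_SucI below_add mult_below)
qed simp

lemma ext_mult_below: "l \<in> below n \<Longrightarrow> m \<in> below k \<Longrightarrow> l * m \<in> ext"
proof (induction k arbitrary: m)
  case 0
  then show ?case using zero_below by (auto simp: ext_def)
next
  case (Suc k)
  then obtain b m' where *: "m = b * x ^ k + m'" "b \<in> A" "m' \<in> below k" by auto
  have "l * b * x ^ k \<in> below (n + k)"
    using below_mult_power[OF below_mult[OF Suc.prems(1) *(2)]] .
  moreover obtain j where "l * m' \<in> below j"
    using Suc.IH[OF Suc.prems(1) *(3)] by (auto simp: ext_def)
  ultimately have "l * b * x ^ k + l * m' \<in> below (max (n + k) j)"
    using monoD[OF mono_below] by (intro below_add) (meson max.cobounded1 max.cobounded2 subsetD)+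
  then show ?case by (auto simp: ext_def * algebra_simps)
qed

lemma A_subset_ext: "A \<subseteq> ext"
  unfolding ext_def using monom_below[of _ 0] by (intro subsetI UN_I[of 1]) (simp_all del: below.simps)

lemma var_in_ext: "x \<in> ext"
  unfolding ext_def using monom_below[OF A_closed(1), of 1]
  by (intro UN_I[of 2]) (simp_all add: numeral_2_eq_2 del: below.simps)

lemma subring_ext: "unital_subring ext"
proof (rule unital_subringI)
  show "1 \<in> ext" using A_subset_ext A_closed(1) by blast
  fix a b assume "a \<in> ext" "b \<in> ext"
  then obtain n k where nk: "a \<in> below n" "b \<in> below k" by (auto simp: ext_def)
  then show "a * b \<in> ext" by (rule ext_mult_below)
  from nk have "a - b \<in> below (max n k)"
    using monoD[OF mono_below] by (intro below_diff) (meson max.cobounded1 max.cobounded2 subsetD)+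
  then show "a - b \<in> ext" by (auto simp: ext_def)
qed

text \<open>Describing the extension by generators makes it possible to adjoin several variables in
  succession.\<close>

lemma ext_eq_hull: "ext = unital_subring hull (insert x A)"
proof (rule hull_unique[symmetric])
  show "insert x A \<subseteq> ext" using A_subset_ext var_in_ext by blast
  fix S assume S: "insert x A \<subseteq> S" "unital_subring S"
  note S_closed = unital_subring_closed[OF S(2)]
  have "x ^ n \<in> S" for n
    by (induction n) (use S S_closed in auto)
  then have "below n \<subseteq> S" for n
    by (induction n) (use S(1) in \<open>auto intro!: S_closed(2,4,6)\<close>)
  then show "ext \<subseteq> S" by (auto simp: ext_def)
qed (rule subring_ext)

section \<open>Leading coefficients of right ideals\<close>

definition leading :: "'a set \<Rightarrow> nat \<Rightarrow> 'a set"
  where "leading J n = {a \<in> A. \<exists>l\<in>below n. a * x ^ n + l \<in> J}"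

lemma leadingI: "a \<in> A \<Longrightarrow> l \<in> below n \<Longrightarrow> a * x ^ n + l \<in> J \<Longrightarrow> a \<in> leading J n"
  by (auto simp: leading_def)

text \<open>Right multiplication by \<open>x\<close> raises the degree and keeps the top
  coefficient, because coefficients stand on the left.\<close>

lemma mono_leading:
  assumes "right_ideal_in ext J"
  shows "mono (leading J)"
proof (rule incseq_SucI, rule subsetI)
  fix n a assume "a \<in> leading J n"
  then obtain l where l: "a \<in> A" "l \<in> below n" "a * x ^ n + l \<in> J" by (auto simp: leading_def)
  have "(a * x ^ n + l) * x \<in> J" using right_ideal_inD(6)[OF assms l(3) var_in_ext] .
  then have "a * x ^ Suc n + l * x \<in> J" by (simp add: algebra_simps power_commutes)
  with l below_mult_var show "a \<in> leading J (Suc n)" by (intro leadingI) auto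
qed

lemma right_ideal_leading:
  assumes "right_ideal_in ext J"
  shows "right_ideal_in A (leading J n)"
  unfolding right_ideal_in_def
proof (intro conjI ballI)
  note J = right_ideal_inD[OF assms]
  show "leading J n \<subseteq> A" by (auto simp: leading_def)
  show "0 \<in> leading J n" using A_closed(2) zero_below J(2) by (intro leadingI[of _ 0]) auto
  fix a assume "a \<in> leading J n"
  then obtain l where l: "a \<in> A" "l \<in> below n" "a * x ^ n + l \<in> J" by (auto simp: leading_def)
  show "a - b \<in> leading J n" if b: "b \<in> leading J n" for b
  proof -
    obtain m where m: "b \<in> A" "m \<in> below n" "b * x ^ n + m \<in> J"
      using b by (auto simp: leading_def)
    have "(a - b) * x ^ n + (l - m) \<in> J" using J(5)[OF l(3) m(3)] by (simp add: algebra_simps)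
    with l m show ?thesis by (intro leadingI) (auto intro: A_closed below_diff)
  qed
  show "a * b \<in> leading J n" if b: "b \<in> A" for b
  proof -
    obtain c m where c: "c \<in> A" "m \<in> below n" "x ^ n * c = b * x ^ n + m"
      using mult_power[OF b] by blast
    have "(a * x ^ n + l) * c \<in> J" using J(6)[OF l(3)] c(1) A_subset_ext by blast
    also have "(a * x ^ n + l) * c = (a * b) * x ^ n + (a * m + l * c)"
      by (simp add: distrib_right mult.assoc c(3) distrib_left)
    finally show ?thesis
      using l b c by (intro leadingI) (auto intro: A_closed below_add mult_below below_mult)
  qed
qed

lemma subset_leading:
  assumes "right_ideal_in ext J" "I \<subseteq> A" "I \<subseteq> J"
  shows "I \<subseteq> leading J n"
proof -
  have "I \<subseteq> leading J 0" using assms by (auto simp: leading_def)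
  also have "\<dots> \<subseteq> leading J n" using mono_leading[OF assms(1)] by (auto dest: monoD)
  finally show ?thesis .
qed

text \<open>Subtract from an element of \<open>J\<close> an element of \<open>K\<close> with the
  same top term. The difference stays in \<open>J\<close> because \<open>K\<close> does, and has
  lower degree, so induction applies.\<close>

lemma subset_of_leading_subset:
  assumes J: "right_ideal_in ext J" and K: "right_ideal_in ext K" and "K \<subseteq> J"
    and lead: "\<And>n. leading J n \<subseteq> leading K n"
  shows "J \<subseteq> K"
proof -
  have "u \<in> K" if "u \<in> J" "u \<in> below n" for u n
    using that
  proof (induction n arbitrary: u)
    case 0
    then show ?case using right_ideal_inD(2)[OF K] by simp
  next
    case (Suc n)
    then obtain a l where u: "u = a * x ^ n + l" "a \<in> A" "l \<in> below n" by auto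
    then have "a \<in> leading J n" using Suc.prems by (auto intro: leadingI)
    then obtain m where m: "m \<in> below n" "a * x ^ n + m \<in> K"
      using lead by (fastforce simp: leading_def)
    have "u - (a * x ^ n + m) \<in> J"
      using right_ideal_inD(5)[OF J Suc.prems(1)] m(2) \<open>K \<subseteq> J\<close> by blast
    then have "l - m \<in> K" using u m by (intro Suc.IH) (auto intro: below_diff)
    then have "(l - m) + (a * x ^ n + m) \<in> K" using right_ideal_inD(4)[OF K] m(2) by blast
    then show ?case by (simp add: u algebra_simps)
  qed
  then show ?thesis using right_ideal_inD(1)[OF J] by (auto simp: ext_def)
qed

text \<open>The leading ideals increase to a right ideal of \<open>A\<close> with a finite
  generating set \<open>G\<close> over \<open>I\<close>, which is reached in some degree
  \<open>N\<close>. Lifts to \<open>J\<close> of \<open>G\<close> and of finite generating sets in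
  degrees up to \<open>N\<close> generate \<open>J\<close> over \<open>I\<close>.\<close>

theorem hilbert_basis:
  assumes "I \<subseteq> A" "right_noetherian_over I A"
  shows "right_noetherian_over I ext"
  unfolding right_noetherian_over_def
proof (intro allI impI, elim conjE)
  fix J assume J: "right_ideal_in ext J" and IJ: "I \<subseteq> J"
  note Jn = right_ideal_leading[OF J] and mono_J = mono_leading[OF J]
  have union: "right_ideal_in A (\<Union>n. leading J n)"
    unfolding right_ideal_in_def
  proof (intro conjI ballI)
    show "(\<Union>n. leading J n) \<subseteq> A" "0 \<in> (\<Union>n. leading J n)"
      using right_ideal_inD[OF Jn] by auto
    show "a * b \<in> (\<Union>n. leading J n)" if "a \<in> (\<Union>n. leading J n)" "b \<in> A" for a b
      using that right_ideal_inD(6)[OF Jn] by blast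
    fix a b assume "a \<in> (\<Union>n. leading J n)" "b \<in> (\<Union>n. leading J n)"
    then obtain N where "{a, b} \<subseteq> leading J N" using finite_subset_chain[OF mono_J, of "{a, b}"] by auto
    then show "a - b \<in> (\<Union>n. leading J n)" using right_ideal_inD(5)[OF Jn[of N], of a b] by auto
  qed
  moreover have "I \<subseteq> (\<Union>n. leading J n)" using subset_leading[OF J \<open>I \<subseteq> A\<close> IJ] by blast
  ultimately obtain G where G: "G \<subseteq> (\<Union>n. leading J n)" "finite G"
    "\<And>K. right_ideal_in A K \<Longrightarrow> I \<subseteq> K \<Longrightarrow> G \<subseteq> K \<Longrightarrow> (\<Union>n. leading J n) \<subseteq> K"
    using right_noetherian_overE[OF assms(2)] by metis
  obtain N where N: "G \<subseteq> leading J N" using finite_subset_chain[OF mono_J G(2,1)] .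
  have "\<exists>H\<subseteq>leading J n. finite H \<and>
      (\<forall>K. right_ideal_in A K \<and> I \<subseteq> K \<and> H \<subseteq> K \<longrightarrow> leading J n \<subseteq> K)" for n
    using assms(2) Jn[of n] subset_leading[OF J \<open>I \<subseteq> A\<close> IJ, of n]
    unfolding right_noetherian_over_def by blast
  then obtain H where H: "\<And>n. H n \<subseteq> leading J n" "\<And>n. finite (H n)"
    "\<And>n K. right_ideal_in A K \<Longrightarrow> I \<subseteq> K \<Longrightarrow> H n \<subseteq> K \<Longrightarrow> leading J n \<subseteq> K"
    by metis
  \<comment> \<open>\<open>G\<close> joins the generators in degree \<open>N\<close>; as it
    generates the union of all leading ideals over \<open>I\<close>, it takes care of every degree
    above \<open>N\<close>.\<close>
  define H' where "H' n = (if n = N then H n \<union> G else H n)" for n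
  have H': "H' n \<subseteq> leading J n" for n using H(1) N by (auto simp: H'_def)
  \<comment> \<open>\<open>l n a\<close> is the lower-order tail of a chosen element of
    \<open>J\<close> with leading coefficient \<open>a\<close> in degree \<open>n\<close>.\<close>
  have "\<exists>l. \<forall>n. \<forall>a\<in>H' n. l n a \<in> below n \<and> a * x ^ n + l n a \<in> J"
    by (intro choice allI bchoice) (use H' in \<open>fastforce simp: leading_def\<close>)
  then obtain l where l: "\<And>n a. a \<in> H' n \<Longrightarrow> l n a \<in> below n \<and> a * x ^ n + l n a \<in> J"
    by blast
  define gens where "gens = (\<Union>n\<le>N. (\<lambda>a. a * x ^ n + l n a) ` H' n)"
  have "J \<subseteq> K" if K: "right_ideal_in ext K" "I \<subseteq> K" "gens \<subseteq> K" for K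
  proof -
    \<comment> \<open>The comparison of leading ideals asks for an ideal inside \<open>J\<close>.
      Intersecting with \<open>J\<close> loses no generator, since all of \<open>gens\<close> and
      \<open>I\<close> lie in \<open>J\<close>.\<close>
    define K' where "K' = K \<inter> J"
    have K': "right_ideal_in ext K'" using K(1) J by (auto simp: K'_def right_ideal_in_def)
    have IK': "I \<subseteq> leading K' n" for n
      using subset_leading[OF K' \<open>I \<subseteq> A\<close>] K(2) IJ by (auto simp: K'_def)
    have small: "H' n \<subseteq> leading K' n" if "n \<le> N" for n
    proof
      fix a assume a: "a \<in> H' n"
      then have "a * x ^ n + l n a \<in> gens" using that by (auto simp: gens_def)
      then have "a * x ^ n + l n a \<in> K'" using l[OF a] K(3) by (auto simp: K'_def)
      then show "a \<in> leading K' n"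
        using a l H'[of n] by (intro leadingI[of _ "l n a"]) (auto simp: leading_def)
    qed
    have "leading J n \<subseteq> leading K' n" for n
    proof (cases "n \<le> N")
      case True
      then show ?thesis
        using small[OF True] by (intro H(3) right_ideal_leading K' IK') (auto simp: H'_def split: if_splits)
    next
      case False
      have "G \<subseteq> leading K' N" using small[of N] by (auto simp: H'_def)
      also have "\<dots> \<subseteq> leading K' n" using monoD[OF mono_leading[OF K']] False by auto
      finally show ?thesis using G(3)[OF right_ideal_leading[OF K'] IK'] by blast
    qed
    then have "J \<subseteq> K'" by (intro subset_of_leading_subset[OF J K']) (auto simp: K'_def)
    then show ?thesis by (simp add: K'_def)
  qed
  moreover have "gens \<subseteq> J" using l by (auto simp: gens_def)
  moreover have "finite gens" using H(2) G(2) by (auto simp: gens_def H'_def)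
  ultimately show "\<exists>G\<subseteq>J. finite G \<and> (\<forall>K. right_ideal_in ext K \<and> I \<subseteq> K \<and> G \<subseteq> K \<longrightarrow> J \<subseteq> K)"
    by blast
qed

end

section \<open>Checking the extension conditions on generators\<close>

lemma unital_subring_var_mult:
  assumes "unital_subring A"
  shows "unital_subring {a \<in> A. \<exists>b\<in>A. \<exists>c\<in>A. x * a = b * x + c}" (is "unital_subring ?S")
proof (rule unital_subringI)
  note A_closed = unital_subring_closed[OF assms]
  have "x * 1 = 1 * x + 0" by simp
  then show "1 \<in> ?S" using A_closed(1,2) by blast
  fix u v assume "u \<in> ?S" "v \<in> ?S"
  then obtain b c b' c' where *: "u \<in> A" "v \<in> A" "b \<in> A" "c \<in> A" "b' \<in> A" "c' \<in> A"
    and u: "x * u = b * x + c" and v: "x * v = b' * x + c'" by blast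
  have "x * (u - v) = (b - b') * x + (c - c')"
    by (simp only: right_diff_distrib left_diff_distrib u v) simp
  then show "u - v \<in> ?S" using * A_closed(5) by blast
  have "x * (u * v) = (b * x + c) * v" by (simp only: u flip: mult.assoc)
  also have "\<dots> = b * (x * v) + c * v" by (simp only: distrib_right mult.assoc)
  also have "\<dots> = (b * b') * x + (b * c' + c * v)"
    by (simp only: v distrib_left mult.assoc add.assoc)
  finally show "u * v \<in> ?S" using * A_closed(4,6) by blast
qed

lemma unital_subring_mult_var:
  assumes "unital_subring A"
  shows "unital_subring {a \<in> A. \<exists>b\<in>A. \<exists>c\<in>A. a * x = x * b + c}" (is "unital_subring ?S")
proof (rule unital_subringI)
  note A_closed = unital_subring_closed[OF assms]
  have "1 * x = x * 1 + 0" by simp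
  then show "1 \<in> ?S" using A_closed(1,2) by blast
  fix u v assume "u \<in> ?S" "v \<in> ?S"
  then obtain b c b' c' where *: "u \<in> A" "v \<in> A" "b \<in> A" "c \<in> A" "b' \<in> A" "c' \<in> A"
    and u: "u * x = x * b + c" and v: "v * x = x * b' + c'" by blast
  have "(u - v) * x = x * (b - b') + (c - c')"
    by (simp only: right_diff_distrib left_diff_distrib u v) simp
  then show "u - v \<in> ?S" using * A_closed(5) by blast
  have "(u * v) * x = u * (x * b' + c')" by (simp only: v mult.assoc)
  also have "\<dots> = (u * x) * b' + u * c'" by (simp only: distrib_left mult.assoc)
  also have "\<dots> = x * (b * b') + (c * b' + u * c')"
    by (simp only: u distrib_right mult.assoc add.assoc)
  finally show "u * v \<in> ?S" using * A_closed(4,6) by blast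
qed

text \<open>The elements of \<open>A\<close> that can be moved past \<open>x\<close> in a given
  direction form a subring, so it contains \<open>A\<close> as soon as it contains the
  generators.\<close>

lemma skew_extension_hullI:
  fixes X :: "'a::ring_1 set"
  defines "A \<equiv> unital_subring hull X"
  assumes left: "\<And>g. g \<in> X \<Longrightarrow> \<exists>b\<in>A. \<exists>c\<in>A. x * g = b * x + c"
    and right: "\<And>g. g \<in> X \<Longrightarrow> \<exists>b\<in>A. \<exists>c\<in>A. g * x = x * b + c"
  shows "skew_extension A x"
proof
  show sub: "unital_subring A" unfolding A_def by (rule unital_subring_hull)
  have XA: "X \<subseteq> A" unfolding A_def by (rule hull_subset)
  have min: "A \<subseteq> S" if "unital_subring S" "X \<subseteq> S" for S
    unfolding A_def using that(2,1) by (rule hull_minimal)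
  fix a assume a: "a \<in> A"
  have "A \<subseteq> {a \<in> A. \<exists>b\<in>A. \<exists>c\<in>A. x * a = b * x + c}"
    using left XA by (intro min unital_subring_var_mult[OF sub]) blast
  with a show "\<exists>b\<in>A. \<exists>c\<in>A. x * a = b * x + c" by blast
  have "A \<subseteq> {a \<in> A. \<exists>b\<in>A. \<exists>c\<in>A. a * x = x * b + c}"
    using right XA by (intro min unital_subring_mult_var[OF sub]) blast
  with a show "\<exists>b\<in>A. \<exists>c\<in>A. a * x = x * b + c" by blast
qed

lemma right_noetherian_over_hull_insert:
  assumes "right_noetherian_over I (unital_subring hull X)" "I \<subseteq> X"
    and "\<And>g. g \<in> X \<Longrightarrow> \<exists>b\<in>unital_subring hull X. \<exists>c\<in>unital_subring hull X. x * g = b * x + c"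
    and "\<And>g. g \<in> X \<Longrightarrow> \<exists>b\<in>unital_subring hull X. \<exists>c\<in>unital_subring hull X. g * x = x * b + c"
  shows "right_noetherian_over I (unital_subring hull (insert x X))"
proof -
  interpret skew_extension "unital_subring hull X" x
    by (rule skew_extension_hullI[OF assms(3,4)])
  have "I \<subseteq> unital_subring hull X" by (rule order.trans[OF assms(2) hull_subset])
  from hilbert_basis[OF this assms(1)] show ?thesis unfolding ext_eq_hull hull_insert[symmetric] .
qed


section \<open>Ideals of the free algebra\<close>

definition heisenberg_ideal :: "complex poly \<Rightarrow> free_alg set"
  where "heisenberg_ideal f = Idl\<^bsub>free_alg_ring\<^esub> (heisenberg_relations f)"

lemma free_alg_ring_simps [simp]:
  "carrier free_alg_ring = UNIV" "a \<otimes>\<^bsub>free_alg_ring\<^esub> b = a * b" "a \<oplus>\<^bsub>free_alg_ring\<^esub> b = a + b"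
  "\<one>\<^bsub>free_alg_ring\<^esub> = 1" "\<zero>\<^bsub>free_alg_ring\<^esub> = 0"
  by (simp_all add: free_alg_ring_def)

interpretation free_alg: ring free_alg_ring
  by (rule ring_free_alg_ring)

lemma free_alg_ring_a_inv [simp]: "\<ominus>\<^bsub>free_alg_ring\<^esub> a = - a"
  by (rule free_alg.minus_equality) simp_all

lemma additive_subgroup_free_alg_ring:
  "additive_subgroup J free_alg_ring \<longleftrightarrow> 0 \<in> J \<and> (\<forall>a\<in>J. \<forall>b\<in>J. a - b \<in> J)"
proof
  assume "additive_subgroup J free_alg_ring"
  then interpret additive_subgroup J free_alg_ring .
  have "0 \<in> J" using zero_closed by simp
  moreover have "a - b \<in> J" if "a \<in> J" "b \<in> J" for a b
    using a_closed[OF that(1) subgroup.m_inv_closed[OF a_subgroup that(2)]]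
    unfolding a_inv_def[symmetric] by simp
  ultimately show "0 \<in> J \<and> (\<forall>a\<in>J. \<forall>b\<in>J. a - b \<in> J)" by blast
next
  assume J: "0 \<in> J \<and> (\<forall>a\<in>J. \<forall>b\<in>J. a - b \<in> J)"
  then have neg: "- a \<in> J" if "a \<in> J" for a using that by (metis diff_0)
  then have "a + b \<in> J" if "a \<in> J" "b \<in> J" for a b using J that by (metis diff_minus_eq_add)
  with neg J show "additive_subgroup J free_alg_ring"
    by (intro additive_subgroupI free_alg.add.subgroupI) (auto simp flip: a_inv_def)
qed

lemma right_ideal_free_alg_ring:
  "right_ideal J free_alg_ring \<longleftrightarrow> right_ideal_in UNIV J"
  by (auto simp: right_ideal_def right_ideal_axioms_def right_ideal_in_def ring_free_alg_ring
      additive_subgroup_free_alg_ring)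

lemma ideal_heisenberg_ideal: "ideal (heisenberg_ideal f) free_alg_ring"
  unfolding heisenberg_ideal_def by (rule free_alg.genideal_ideal) simp

lemma right_ideal_heisenberg_ideal: "right_ideal_in UNIV (heisenberg_ideal f)"
proof -
  interpret ideal "heisenberg_ideal f" free_alg_ring by (rule ideal_heisenberg_ideal)
  show ?thesis
    using additive_subgroup_axioms I_r_closed
    by (auto simp: right_ideal_in_def additive_subgroup_free_alg_ring)
qed

lemma heisenberg_ideal_l_closed: "a \<in> heisenberg_ideal f \<Longrightarrow> b * a \<in> heisenberg_ideal f"
  using ideal.I_l_closed[OF ideal_heisenberg_ideal] by simp

lemma relations_subset_heisenberg_ideal: "heisenberg_relations f \<subseteq> heisenberg_ideal f"
  unfolding heisenberg_ideal_def by (rule free_alg.genideal_self) simp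

lemma heisenberg_ideal_subset:
  assumes "right_ideal_in UNIV J" "\<And>a b. a \<in> J \<Longrightarrow> b * a \<in> J" "heisenberg_relations f \<subseteq> J"
  shows "heisenberg_ideal f \<subseteq> J"
  unfolding heisenberg_ideal_def
proof (rule free_alg.genideal_minimal)
  show "ideal J free_alg_ring"
    using assms(1,2)
    by (auto simp: ideal_def ideal_axioms_def ring_free_alg_ring additive_subgroup_free_alg_ring
        right_ideal_in_def)
qed (rule assms(3))

lemma scalar_simps:
  "scalar 0 = 0" "scalar 1 = 1" "scalar c * scalar d = scalar (c * d)"
  "scalar c - scalar d = scalar (c - d)"
  by (simp_all add: scalar_def mult_single single_diff single_one)

lemma free_alg_induct [case_names zero add]:
  fixes a :: free_alg
  assumes "P 0" "\<And>a w c. P a \<Longrightarrow> P (a + Poly_Mapping.single w c)"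
  shows "P a"
proof (induction a rule: update_induct)
  case (update a w c)
  have "Poly_Mapping.update w c a = a + Poly_Mapping.single w c"
    using update.hyps
    by (intro poly_mapping_eqI) (auto simp: lookup_update lookup_add lookup_single when_def
        in_keys_iff)
  then show ?case using assms(2) update.IH by simp
qed (rule assms(1))

text \<open>Ensures that adjoining the three generators to the scalars ends with the whole free
  algebra.\<close>

lemma free_alg_generated:
  "unital_subring hull (range scalar \<union> range var) = UNIV" (is "?A = _")
proof -
  note A = unital_subring_closed[OF unital_subring_hull[of "range scalar \<union> range var"]]
  have word: "Poly_Mapping.single w 1 \<in> ?A" for w
  proof (induction "letters w" arbitrary: w)
    case Nil
    then have "w = 0" by (cases w) (simp add: zero_word_def)
    then show ?case using A(1) by (simp add: single_one)
  next
    case (Cons g gs)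
    then have "w = Word [g] + Word gs" by (cases w) (simp add: plus_word_def)
    then have "Poly_Mapping.single w 1 = var g * Poly_Mapping.single (Word gs) 1"
      by (simp add: var_def mult_single)
    moreover have "var g \<in> ?A" by (rule hull_inc) simp
    ultimately show ?case using A(6) Cons(1)[of "Word gs"] by simp
  qed
  have "a \<in> ?A" for a
  proof (induction a rule: free_alg_induct)
    case zero
    show ?case using A(2) .
  next
    case (add a w c)
    have "Poly_Mapping.single w c = scalar c * Poly_Mapping.single w 1"
      by (simp add: scalar_def mult_single)
    moreover have "scalar c \<in> ?A" by (rule hull_inc) simp
    ultimately show ?case using A(4,6) add word by simp
  qed
  then show ?thesis by blast
qed


section \<open>The case of degree one\<close>

text \<open>Base of the tower: modulo \<open>I\<close> every element of this subring is a scalar. A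
  right ideal containing \<open>I\<close> properly therefore contains a nonzero scalar, a unit, and
  is the whole subring.\<close>

lemma right_noetherian_over_scalars:
  assumes I: "right_ideal_in UNIV I" and I_l: "\<And>a b. a \<in> I \<Longrightarrow> b * a \<in> I"
  shows "right_noetherian_over I (unital_subring hull (range scalar \<union> I))"
  unfolding right_noetherian_over_def
proof (intro allI impI, elim conjE)
  let ?A = "unital_subring hull (range scalar \<union> I)"
  note I' = right_ideal_inD[OF I]
  have A: "\<exists>c. a - scalar c \<in> I" if "a \<in> ?A" for a
  proof -
    have "?A \<subseteq> {a. \<exists>c. a - scalar c \<in> I}"
    proof (rule hull_minimal)
      have "a - scalar 0 \<in> I" if "a \<in> I" for a using that by (simp add: scalar_simps)
      moreover have "scalar c - scalar c \<in> I" for c using I'(2) by simp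
      ultimately show "range scalar \<union> I \<subseteq> {a. \<exists>c. a - scalar c \<in> I}" by blast
      show "unital_subring {a. \<exists>c. a - scalar c \<in> I}"
      proof (rule unital_subringI)
        have "1 - scalar 1 \<in> I" using I'(2) by (simp add: scalar_simps)
        then show "1 \<in> {a. \<exists>c. a - scalar c \<in> I}" by blast
        fix a b assume "a \<in> {a. \<exists>c. a - scalar c \<in> I}" "b \<in> {a. \<exists>c. a - scalar c \<in> I}"
        then obtain c d where cd: "a - scalar c \<in> I" "b - scalar d \<in> I" by blast
        have "(a - b) - scalar (c - d) = (a - scalar c) - (b - scalar d)"
          by (simp flip: scalar_simps)
        then show "a - b \<in> {a. \<exists>c. a - scalar c \<in> I}" using I'(5)[OF cd] by (metis CollectI)
        have "a * b - scalar (c * d) = (a - scalar c) * b + scalar c * (b - scalar d)"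
          by (simp add: left_diff_distrib right_diff_distrib scalar_simps(3))
        then show "a * b \<in> {a. \<exists>c. a - scalar c \<in> I}"
          using I'(4)[OF I'(6)[OF cd(1), of b] I_l[OF cd(2), of "scalar c"]] by (metis CollectI UNIV_I)
      qed
    qed
    with that show ?thesis by blast
  qed
  fix J assume J: "right_ideal_in ?A J" and "I \<subseteq> J"
  show "\<exists>G\<subseteq>J. finite G \<and> (\<forall>K. right_ideal_in ?A K \<and> I \<subseteq> K \<and> G \<subseteq> K \<longrightarrow> J \<subseteq> K)"
  proof (cases "J \<subseteq> I")
    case True
    then show ?thesis by (intro exI[of _ "{}"]) auto
  next
    case False
    then obtain a where a: "a \<in> J" "a \<notin> I" by blast
    obtain c where c: "a - scalar c \<in> I" using A a(1) right_ideal_inD(1)[OF J] by blast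
    then have "c \<noteq> 0" using a(2) by (auto simp: scalar_simps)
    have "J \<subseteq> K" if K: "right_ideal_in ?A K" "I \<subseteq> K" "a \<in> K" for K
    proof
      fix b assume "b \<in> J"
      then have b: "b \<in> ?A" using right_ideal_inD(1)[OF J] by blast
      have "a - (a - scalar c) \<in> K" using right_ideal_inD(5)[OF K(1) K(3)] c K(2) by blast
      then have "scalar c * scalar (1 / c) \<in> K"
        using right_ideal_inD(6)[OF K(1)] hull_inc[of "scalar (1 / c)" "range scalar \<union> I"] by simp
      then have "1 \<in> K" using \<open>c \<noteq> 0\<close> by (simp add: scalar_simps)
      from right_ideal_inD(6)[OF K(1) this b] show "b \<in> K" by simp
    qed
    then show ?thesis using a(1) by (intro exI[of _ "{a}"]) auto
  qed
qed

text \<open>Adjoins \<open>h\<close>, \<open>x\<close>, \<open>y\<close> in this order to the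
  scalars and the ideal. Since the linear coefficient of \<open>f\<close> is invertible, the first
  two relations can be solved so that \<open>h\<close> passes \<open>x\<close> and \<open>y\<close>
  in both directions.\<close>

lemma right_noetherian_over_heisenberg_ideal:
  assumes "Polynomial.degree f = 1"
  shows "right_noetherian_over (heisenberg_ideal f) UNIV"
proof -
  let ?I = "heisenberg_ideal f" and ?h = "var Gen_h" and ?x = "var Gen_x" and ?y = "var Gen_y"
  define a b where "a = Polynomial.coeff f 1" and "b = Polynomial.coeff f 0"
  have "a \<noteq> 0" using assms leading_coeff_neq_0[of f] unfolding a_def by force
  have f: "poly_h f = scalar b + scalar a * ?h"
    using assms by (simp add: poly_h_def a_def b_def)
  \<comment> \<open>\<open>k\<close> is the inverse of the affine map \<open>f\<close> evaluated at
    \<open>h\<close>. Modulo the ideal, the relations become \<open>x h = k x\<close> and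
    \<open>h y = y k\<close>.\<close>
  define k where "k = scalar (1 / a) * (?h - scalar b)"
  note I_closed = right_ideal_inD[OF right_ideal_heisenberg_ideal[of f]]
  have inv: "scalar (1 / a) * scalar a = 1" "scalar a * scalar (1 / a) = 1"
    using \<open>a \<noteq> 0\<close> by (simp_all add: scalar_simps)
  have hx: "?h * ?x - ?x * poly_h f \<in> ?I" and yh: "?y * ?h - poly_h f * ?y \<in> ?I"
    and yx: "?y * ?x - ?x * ?y - (poly_h f - ?h) \<in> ?I"
    using relations_subset_heisenberg_ideal[of f] by (auto simp: heisenberg_relations_def)
  have xk: "?x * poly_h f - ?h * ?x = - (?h * ?x - ?x * poly_h f)" by simp
  have "?x * ?h - k * ?x = scalar (1 / a) * (?x * poly_h f - ?h * ?x)"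
  proof -
    have "scalar (1 / a) * (?x * poly_h f - ?h * ?x) =
        ?x * (scalar (1 / a) * scalar a * ?h) + scalar (1 / a) * (scalar b * ?x) - scalar (1 / a) * (?h * ?x)"
      unfolding f by (simp add: algebra_simps scalar_central[of _ ?x]) (metis mult.assoc scalar_central)
    then show ?thesis by (simp add: inv k_def algebra_simps)
  qed
  then have xh: "?x * ?h - k * ?x \<in> ?I"
    unfolding xk using heisenberg_ideal_l_closed[OF I_closed(3)[OF hx]] by simp
  have "?h * ?y - ?y * k = - (scalar (1 / a) * (?y * ?h - poly_h f * ?y))"
  proof -
    have "scalar (1 / a) * (?y * ?h - poly_h f * ?y) =
        scalar (1 / a) * (?y * ?h) - scalar (1 / a) * (scalar b * ?y) - scalar (1 / a) * scalar a * (?h * ?y)"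
      unfolding f by (simp add: algebra_simps)
    moreover have "?y * k = scalar (1 / a) * (?y * ?h) - scalar (1 / a) * (scalar b * ?y)"
      unfolding k_def by (simp add: right_diff_distrib scalar_central[of b])
        (metis mult.assoc scalar_central)
    ultimately show ?thesis by (simp add: inv)
  qed
  then have hy: "?h * ?y - ?y * k \<in> ?I"
    using I_closed(3)[OF heisenberg_ideal_l_closed[OF yh]] by simp
  have xy: "?x * ?y - ?y * ?x - (?h - poly_h f) \<in> ?I"
    using I_closed(3)[OF yx] by (simp add: algebra_simps)

  have scalars: "\<exists>b\<in>unital_subring hull X. \<exists>c\<in>unital_subring hull X. v * scalar s = b * v + c"
    "\<exists>b\<in>unital_subring hull X. \<exists>c\<in>unital_subring hull X. scalar s * v = v * b + c"
    if "range scalar \<subseteq> X" for X s v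
  proof -
    have "scalar s \<in> unital_subring hull X" using that by (intro hull_inc) blast
    moreover have "v * scalar s = scalar s * v + 0" "scalar s * v = v * scalar s + 0"
      by (simp_all add: scalar_central)
    ultimately show
      "\<exists>b\<in>unital_subring hull X. \<exists>c\<in>unital_subring hull X. v * scalar s = b * v + c"
      "\<exists>b\<in>unital_subring hull X. \<exists>c\<in>unital_subring hull X. scalar s * v = v * b + c"
      using unital_subring_closed(2)[OF unital_subring_hull[of X]] by blast+
  qed
  \<comment> \<open>For an element of the ideal the whole product counts as lower-order term:
    \<open>b = 0\<close> and \<open>c\<close> is again in the ideal.\<close>
  have ideal: "\<exists>b\<in>unital_subring hull X. \<exists>c\<in>unital_subring hull X. v * i = b * v + c"
    "\<exists>b\<in>unital_subring hull X. \<exists>c\<in>unital_subring hull X. i * v = v * b + c"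
    if "i \<in> ?I" "?I \<subseteq> X" for X i v
  proof -
    have "v * i \<in> unital_subring hull X" "i * v \<in> unital_subring hull X"
      using that heisenberg_ideal_l_closed[OF that(1)] I_closed(6)[OF that(1)]
      by (auto intro!: hull_inc)
    moreover have "v * i = 0 * v + v * i" "i * v = v * 0 + i * v" by simp_all
    ultimately show
      "\<exists>b\<in>unital_subring hull X. \<exists>c\<in>unital_subring hull X. v * i = b * v + c"
      "\<exists>b\<in>unital_subring hull X. \<exists>c\<in>unital_subring hull X. i * v = v * b + c"
      using unital_subring_closed(2)[OF unital_subring_hull[of X]] by blast+
  qed
  \<comment> \<open>Since the ideal is among the generators \<open>X\<close>, the error of a
    congruence is absorbed into \<open>c\<close>. The commutation rules are thus only needed modulo
    the ideal.\<close>
  have modulo: "\<exists>b\<in>unital_subring hull X. \<exists>c\<in>unital_subring hull X. u = b * v + c"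
    if "u - p * v - q \<in> ?I" "p \<in> unital_subring hull X" "q \<in> unital_subring hull X" "?I \<subseteq> X"
    for u v p q X
  proof -
    have "u - p * v - q \<in> unital_subring hull X" using that by (intro hull_inc) blast
    then have "q + (u - p * v - q) \<in> unital_subring hull X"
      using unital_subring_closed(4)[OF unital_subring_hull] that(3) by blast
    moreover have "u = p * v + (q + (u - p * v - q))" by simp
    ultimately show ?thesis using that(2) by blast
  qed
  have modulo': "\<exists>b\<in>unital_subring hull X. \<exists>c\<in>unital_subring hull X. u = v * b + c"
    if "u - v * p - q \<in> ?I" "p \<in> unital_subring hull X" "q \<in> unital_subring hull X" "?I \<subseteq> X"
    for u v p q X
  proof -
    have "u - v * p - q \<in> unital_subring hull X" using that by (intro hull_inc) blast
    then have "q + (u - v * p - q) \<in> unital_subring hull X"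
      using unital_subring_closed(4)[OF unital_subring_hull] that(3) by blast
    moreover have "u = v * p + (q + (u - v * p - q))" by simp
    ultimately show ?thesis using that(2) by blast
  qed
  have polys: "0 \<in> unital_subring hull X" "?h \<in> unital_subring hull X"
    "k \<in> unital_subring hull X" "poly_h f \<in> unital_subring hull X"
    "poly_h f - ?h \<in> unital_subring hull X" "?h - poly_h f \<in> unital_subring hull X"
    if "insert ?h (range scalar) \<subseteq> X" for X
  proof -
    note X = unital_subring_closed[OF unital_subring_hull[of X]]
    have "scalar s \<in> unital_subring hull X" for s using that by (intro hull_inc) auto
    moreover show "?h \<in> unital_subring hull X" using that by (intro hull_inc) auto
    ultimately show "0 \<in> unital_subring hull X" "k \<in> unital_subring hull X"
      "poly_h f \<in> unital_subring hull X" "poly_h f - ?h \<in> unital_subring hull X"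
      "?h - poly_h f \<in> unital_subring hull X"
      unfolding k_def f by (auto intro!: X(2,4,5,6))
  qed
  define X where "X = range scalar \<union> ?I"
  have X: "range scalar \<subseteq> X" "?I \<subseteq> X" by (auto simp: X_def)
  have 0: "right_noetherian_over ?I (unital_subring hull X)"
    unfolding X_def
    by (rule right_noetherian_over_scalars[OF right_ideal_heisenberg_ideal heisenberg_ideal_l_closed])
  have 1: "right_noetherian_over ?I (unital_subring hull (insert ?h X))"
  proof (rule right_noetherian_over_hull_insert[OF 0 X(2)])
    fix g assume "g \<in> X"
    then consider s where "g = scalar s" | "g \<in> ?I" by (auto simp: X_def)
    then show "\<exists>b\<in>unital_subring hull X. \<exists>c\<in>unital_subring hull X. ?h * g = b * ?h + c"
      "\<exists>b\<in>unital_subring hull X. \<exists>c\<in>unital_subring hull X. g * ?h = ?h * b + c"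
      by (cases; use X scalars ideal in simp)+
  qed
  have 2: "right_noetherian_over ?I (unital_subring hull (insert ?x (insert ?h X)))"
  proof (rule right_noetherian_over_hull_insert[OF 1])
    let ?X = "insert ?h X"
    show X2: "?I \<subseteq> ?X" using X by blast
    have X1: "range scalar \<subseteq> ?X" "insert ?h (range scalar) \<subseteq> ?X" using X by auto
    fix g assume "g \<in> ?X"
    then consider s where "g = scalar s" | "g \<in> ?I" | "g = ?h" by (auto simp: X_def)
    then show "\<exists>b\<in>unital_subring hull ?X. \<exists>c\<in>unital_subring hull ?X. ?x * g = b * ?x + c"
    proof cases
      case 3
      show ?thesis unfolding 3 using xh by (intro modulo[of _ k _ 0] polys X1 X2) simp
    qed (use X1 X2 scalars ideal in simp_all)
    from \<open>g \<in> ?X\<close> consider s where "g = scalar s" | "g \<in> ?I" | "g = ?h" by (auto simp: X_def)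
    then show "\<exists>b\<in>unital_subring hull ?X. \<exists>c\<in>unital_subring hull ?X. g * ?x = ?x * b + c"
    proof cases
      case 3
      show ?thesis unfolding 3 using hx by (intro modulo'[of _ _ "poly_h f" 0] polys X1 X2) simp
    qed (use X1 X2 scalars ideal in simp_all)
  qed
  have 3: "right_noetherian_over ?I (unital_subring hull (insert ?y (insert ?x (insert ?h X))))"
  proof (rule right_noetherian_over_hull_insert[OF 2])
    let ?X = "insert ?x (insert ?h X)"
    show X2: "?I \<subseteq> ?X" using X by blast
    have X1: "range scalar \<subseteq> ?X" "insert ?h (range scalar) \<subseteq> ?X" using X by auto
    have x: "?x \<in> unital_subring hull ?X" by (rule hull_inc) simp
    fix g assume "g \<in> ?X"
    then consider s where "g = scalar s" | "g \<in> ?I" | "g = ?h" | "g = ?x" by (auto simp: X_def)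
    then show "\<exists>b\<in>unital_subring hull ?X. \<exists>c\<in>unital_subring hull ?X. ?y * g = b * ?y + c"
    proof cases
      case 3
      show ?thesis unfolding 3 using yh by (intro modulo[of _ "poly_h f" _ 0] polys X1 X2) simp
    next
      \<comment> \<open>The third relation, with lower-order term
        \<open>poly_h f - var Gen_h\<close>: this is why the extension conditions allow a summand
        \<open>c\<close>.\<close>
      case 4
      show ?thesis unfolding 4 using yx by (intro modulo[of _ ?x _ "poly_h f - ?h"] polys X1 X2 x)
    qed (use X1 X2 scalars ideal in simp_all)
    from \<open>g \<in> ?X\<close> consider s where "g = scalar s" | "g \<in> ?I" | "g = ?h" | "g = ?x"
      by (auto simp: X_def)
    then show "\<exists>b\<in>unital_subring hull ?X. \<exists>c\<in>unital_subring hull ?X. g * ?y = ?y * b + c"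
    proof cases
      case 3
      show ?thesis unfolding 3 using hy by (intro modulo'[of _ _ k 0] polys X1 X2) simp
    next
      case 4
      show ?thesis unfolding 4 using xy by (intro modulo'[of _ _ ?x "?h - poly_h f"] polys X1 X2 x)
    qed (use X1 X2 scalars ideal in simp_all)
  qed
  have "range var = {?x, ?y, ?h}"
    by (auto simp: image_iff) (metis gen.exhaust)
  then have "range scalar \<union> range var \<subseteq> insert ?y (insert ?x (insert ?h X))"
    by (auto simp: X_def)
  from hull_mono[OF this, of unital_subring] 3 show ?thesis
    by (simp add: free_alg_generated top.extremum_unique)
qed


section \<open>Right modules over the free algebra\<close>

text \<open>\<open>step g v\<close> is the product of \<open>v\<close> with the generator
  \<open>g\<close> on the right. As the algebra is free, arbitrary linear operators define a module;
  the relations are checked separately.\<close>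

locale free_alg_module = Modules.module scale
  for scale :: "complex \<Rightarrow> 'v::ab_group_add \<Rightarrow> 'v" +
  fixes step :: "gen \<Rightarrow> 'v \<Rightarrow> 'v"
  assumes step_add: "step g (u + v) = step g u + step g v"
    and step_scale: "step g (scale c v) = scale c (step g v)"
begin

definition act_word :: "'v \<Rightarrow> word \<Rightarrow> 'v"
  where "act_word v w = fold step (letters w) v"

definition act :: "'v \<Rightarrow> free_alg \<Rightarrow> 'v"
  where "act v a = (\<Sum>w\<in>Poly_Mapping.keys a. scale (Poly_Mapping.lookup a w) (act_word v w))"

lemma fold_step_add: "fold step gs (u + v) = fold step gs u + fold step gs v"
  by (induction gs arbitrary: u v) (simp_all add: step_add)

lemma fold_step_scale: "fold step gs (scale c v) = scale c (fold step gs v)"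
  by (induction gs arbitrary: v) (simp_all add: step_scale)

lemma act_superset:
  assumes "finite S" "Poly_Mapping.keys a \<subseteq> S"
  shows "act v a = (\<Sum>w\<in>S. scale (Poly_Mapping.lookup a w) (act_word v w))"
  unfolding act_def using assms by (intro sum.mono_neutral_left) (auto simp: in_keys_iff)

lemma act_add_right: "act v (a + b) = act v a + act v b"
proof -
  let ?S = "Poly_Mapping.keys a \<union> Poly_Mapping.keys b"
  have "act v (a + b) = (\<Sum>w\<in>?S. scale (Poly_Mapping.lookup (a + b) w) (act_word v w))"
    by (rule act_superset) (simp_all add: Poly_Mapping.keys_add)
  also have "\<dots> = act v a + act v b"
    by (simp add: act_superset[of ?S] lookup_add scale_left_distrib sum.distrib)
  finally show ?thesis .
qed

lemma act_single: "act v (Poly_Mapping.single w c) = scale c (act_word v w)"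
  by (simp add: act_superset[of "{w}"])

lemma act_zero_right: "act v 0 = 0"
  by (simp add: act_def)

lemma act_diff_right: "act v (a - b) = act v a - act v b"
  using act_add_right[of v "a - b" b] by (simp add: algebra_simps)

lemma act_add_left: "act (u + v) a = act u a + act v a"
  by (simp add: act_def act_word_def fold_step_add scale_right_distrib sum.distrib)

lemma act_zero_left: "act 0 a = 0"
  using act_add_left[of 0 0 a] by simp

text \<open>By linearity this reduces to words. There \<open>fold\<close> applies the first letter
  first, so concatenation becomes successive action, in the order of a right module.\<close>

lemma act_mult: "act v (a * b) = act (act v a) b"
proof (induction a rule: free_alg_induct)
  case zero
  show ?case by (simp add: act_zero_left act_zero_right)
next
  case (add a w c)
  have "act v (Poly_Mapping.single w c * b) = act (act v (Poly_Mapping.single w c)) b"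
  proof (induction b rule: free_alg_induct)
    case zero
    show ?case by (simp add: act_zero_right)
  next
    case (add b w' d)
    have "act v (Poly_Mapping.single w c * Poly_Mapping.single w' d) =
        act (act v (Poly_Mapping.single w c)) (Poly_Mapping.single w' d)"
      by (simp add: mult_single act_single plus_word_def act_word_def fold_step_scale mult.commute)
    then show ?case by (simp add: distrib_left act_add_right add)
  qed
  then show ?case by (simp add: distrib_right act_add_right act_add_left add)
qed

lemma act_var: "act v (var g) = step g v"
  by (simp add: var_def act_single act_word_def)

lemma act_scalar: "act v (scalar c) = scale c v"
  by (simp add: scalar_def act_single act_word_def zero_word_def)

lemma act_var_power: "act v (var g ^ n) = (step g ^^ n) v"
proof (induction n)
  case 0
  show ?case using act_scalar[of v 1] by (simp add: scalar_simps)
next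
  case (Suc n)
  then show ?case by (simp add: power_Suc2 act_mult act_var del: power_Suc)
qed

lemma act_sum_right: "act v (sum b S) = (\<Sum>i\<in>S. act v (b i))"
  by (induction S rule: infinite_finite_induct) (simp_all add: act_zero_right act_add_right)

lemma act_poly_h:
  "act v (poly_h p) = (\<Sum>i\<le>Polynomial.degree p. scale (Polynomial.coeff p i) ((step Gen_h ^^ i) v))"
  by (simp add: poly_h_def act_sum_right scalar_central[of _ "var Gen_h ^ _"] act_mult act_scalar
      act_var_power)

text \<open>The elements killing every vector form a two-sided ideal, so it suffices that the
  relations do.\<close>

lemma act_heisenberg_ideal:
  assumes "\<And>v r. r \<in> heisenberg_relations f \<Longrightarrow> act v r = 0" "a \<in> heisenberg_ideal f"
  shows "act v a = 0"
proof -
  have "heisenberg_ideal f \<subseteq> {a. \<forall>v. act v a = 0}"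
    using assms(1)
    by (intro heisenberg_ideal_subset)
      (auto simp: right_ideal_in_def act_zero_right act_diff_right act_mult act_zero_left)
  with assms(2) show ?thesis by blast
qed

lemma act_closed:
  assumes zero: "0 \<in> N" and add: "\<And>u v. u \<in> N \<Longrightarrow> v \<in> N \<Longrightarrow> u + v \<in> N"
    and scale: "\<And>c v. v \<in> N \<Longrightarrow> scale c v \<in> N" and step: "\<And>g v. v \<in> N \<Longrightarrow> step g v \<in> N"
    and v: "v \<in> N"
  shows "act v a \<in> N"
proof -
  have "fold step gs v \<in> N" for gs
    using v by (induction gs arbitrary: v) (auto intro: step)
  then have "act_word v w \<in> N" for w by (simp add: act_word_def)
  then show ?thesis
    by (induction a rule: free_alg_induct)
      (auto simp: act_zero_right act_add_right act_single intro: zero add scale)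
qed

end


section \<open>The case of degree different from one\<close>

definition iter_comp :: "complex poly \<Rightarrow> nat \<Rightarrow> complex poly"
  where "iter_comp f k = (pcompose f ^^ k) [:0, 1:]"

lemma iter_comp_simps: "iter_comp f 0 = [:0, 1:]" "iter_comp f (Suc k) = f \<circ>\<^sub>p iter_comp f k"
  by (simp_all add: iter_comp_def)

text \<open>Needed for the first relation: \<open>x\<close> composes coefficients with
  \<open>f\<close> on the inside, whereas \<open>poly_h f\<close> composes the iterate with
  \<open>f\<close> on the outside.\<close>

lemma iter_comp_pcompose: "iter_comp f k \<circ>\<^sub>p f = f \<circ>\<^sub>p iter_comp f k"
  by (induction k) (simp_all add: iter_comp_simps pcompose_pCons flip: pcompose_assoc)

text \<open>The family \<open>\<phi>\<close> stands for the sum of the elements \<open>x\<^sup>i \<phi>\<^sub>i\<^sub>k(h) y\<^sup>k\<close>; the operators are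
  right multiplications, computed with \<open>y\<^sup>k x = x y\<^sup>k + (f\<^sub>k(h) - h) y\<^bsup>k-1\<^esup>\<close>, where \<open>f\<^sub>k\<close> is
  the \<open>k\<close>-fold iterate of \<open>f\<close>. Only the module axioms are needed, not that this is
  the regular representation.\<close>

fun tower_step :: "complex poly \<Rightarrow> gen \<Rightarrow> (nat \<Rightarrow> nat \<Rightarrow> complex poly) \<Rightarrow> nat \<Rightarrow> nat \<Rightarrow> complex poly"
  where
    "tower_step f Gen_x \<phi> = (\<lambda>i k. (case i of 0 \<Rightarrow> 0 | Suc j \<Rightarrow> \<phi> j k \<circ>\<^sub>p f) +
      \<phi> i (Suc k) * (iter_comp f (Suc k) - [:0, 1:]))"
  | "tower_step f Gen_y \<phi> = (\<lambda>i k. case k of 0 \<Rightarrow> 0 | Suc l \<Rightarrow> \<phi> i l)"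
  | "tower_step f Gen_h \<phi> = (\<lambda>i k. \<phi> i k * iter_comp f k)"

definition tower_scale :: "complex \<Rightarrow> (nat \<Rightarrow> nat \<Rightarrow> complex poly) \<Rightarrow> nat \<Rightarrow> nat \<Rightarrow> complex poly"
  where "tower_scale c \<phi> = (\<lambda>i k. smult c (\<phi> i k))"

interpretation tower: free_alg_module tower_scale "tower_step f" for f
proof
  fix g u v c
  show "tower_step f g (u + v) = tower_step f g u + tower_step f g v"
    by (cases g) (auto simp: fun_eq_iff pcompose_add algebra_simps split: nat.split)
  show "tower_step f g (tower_scale c v) = tower_scale c (tower_step f g v)"
    by (cases g) (auto simp: fun_eq_iff tower_scale_def pcompose_smult smult_add_right split: nat.split)
qed (simp_all add: tower_scale_def fun_eq_iff smult_add_left smult_add_right)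

lemma sum_fun_apply2: "sum b S i k = (\<Sum>j\<in>S. b j i k)"
  by (induction S rule: infinite_finite_induct) simp_all

text \<open>Reflects the rule \<open>y\<^sup>k p(h) = p(f\<^sub>k(h)) y\<^sup>k\<close>, with
  \<open>iter_comp f k\<close> in the place of \<open>f\<^sub>k\<close>.\<close>

lemma tower_act_poly_h: "tower.act f \<phi> (poly_h p) i k = \<phi> i k * (p \<circ>\<^sub>p iter_comp f k)"
proof -
  have pow: "(tower_step f Gen_h ^^ n) \<phi> i k = \<phi> i k * iter_comp f k ^ n" for n
    by (induction n) (simp_all add: mult_ac)
  have "p \<circ>\<^sub>p iter_comp f k = (\<Sum>n\<le>Polynomial.degree p. smult (Polynomial.coeff p n) (iter_comp f k ^ n))"
    by (simp add: pcompose_altdef poly_altdef coeff_map_poly degree_map_poly)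
  then show ?thesis
    by (simp add: tower.act_poly_h sum_fun_apply2 tower_scale_def pow sum_distrib_left)
qed

lemma tower_act_heisenberg_ideal: "a \<in> heisenberg_ideal f \<Longrightarrow> tower.act f \<phi> a = 0"
proof (rule tower.act_heisenberg_ideal)
  fix \<phi> r assume "r \<in> heisenberg_relations f"
  then consider "r = var Gen_h * var Gen_x - var Gen_x * poly_h f"
    | "r = var Gen_y * var Gen_h - poly_h f * var Gen_y"
    | "r = (var Gen_y * var Gen_x - var Gen_x * var Gen_y) - (poly_h f - var Gen_h)"
    by (auto simp: heisenberg_relations_def)
  then show "tower.act f \<phi> r = 0"
  proof cases
    case 1
    show ?thesis unfolding 1
      by (auto simp: fun_eq_iff tower.act_diff_right tower.act_mult tower.act_var tower_act_poly_h
          pcompose_mult iter_comp_pcompose iter_comp_simps algebra_simps split: nat.split)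
  next
    case 2
    show ?thesis unfolding 2
      by (auto simp: fun_eq_iff tower.act_diff_right tower.act_mult tower.act_var tower_act_poly_h
          iter_comp_simps split: nat.split)
  next
    case 3
    \<comment> \<open>The terms shifted by \<open>x\<close> cancel, and at \<open>k\<close> the
      corrections leave \<open>(f\<^sub>k\<^sub>+\<^sub>1 - h) - (f\<^sub>k - h) = f(f\<^sub>k) -
      f\<^sub>k\<close>, the action of \<open>f(h) - h\<close>.\<close>
    show ?thesis unfolding 3 tower.act_diff_right tower.act_mult tower.act_var
      by (auto simp: fun_eq_iff tower_act_poly_h iter_comp_simps algebra_simps split: nat.split)
  qed
qed

section \<open>Submodules given by divisibility conditions\<close>

definition tower_divisor :: "complex poly \<Rightarrow> complex \<Rightarrow> nat \<Rightarrow> nat \<Rightarrow> complex poly"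
  where "tower_divisor f c n i = (if i \<le> n then [:- c, 1:] else f - [:c:])"

text \<open>Designed to contain the image of \<open>x\<^sup>m (h - c)\<close> exactly for
  \<open>m \<le> n\<close>. Beyond row \<open>n\<close> the single divisor \<open>f - c\<close>
  serves for all rows, although composing with \<open>f\<close> repeatedly yields further
  multiples.\<close>

definition tower_submodule :: "complex poly \<Rightarrow> complex \<Rightarrow> nat \<Rightarrow> (nat \<Rightarrow> nat \<Rightarrow> complex poly) set"
  where "tower_submodule f c n = {\<phi>. \<forall>i k. tower_divisor f c n i dvd \<phi> i k}"

lemma fixed_point_dvd:
  assumes "poly f c = (c::complex)"
  shows "[:- c, 1:] dvd f - [:c:]"
  using assms by (simp flip: poly_eq_0_iff_dvd)

text \<open>Passing to the next row under \<open>x\<close> composes with \<open>f\<close>. This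
  sends \<open>h - c\<close> to \<open>f - c\<close>, a multiple of \<open>h - c\<close>; and
  \<open>f - c = (h - c) q\<close> yields
  \<open>(f - c) \<circ> f = (f - c) (q \<circ> f)\<close>.\<close>

lemma tower_divisor_pcompose:
  assumes "poly f c = c"
  shows "tower_divisor f c n (Suc i) dvd tower_divisor f c n i \<circ>\<^sub>p f"
proof -
  have X: "[:- c, 1:] \<circ>\<^sub>p f = f - [:c:]" by (simp add: pcompose_pCons)
  have "f - [:c:] dvd (f - [:c:]) \<circ>\<^sub>p f"
  proof -
    obtain q where "f - [:c:] = [:- c, 1:] * q" using fixed_point_dvd[OF assms] by (rule dvdE)
    then have "(f - [:c:]) \<circ>\<^sub>p f = (f - [:c:]) * (q \<circ>\<^sub>p f)"
      by (metis X pcompose_mult)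
    then show ?thesis by simp
  qed
  then show ?thesis using fixed_point_dvd[OF assms] by (auto simp: tower_divisor_def X)
qed

lemma act_tower_submodule:
  assumes c: "poly f c = c" and "\<phi> \<in> tower_submodule f c n"
  shows "tower.act f \<phi> a \<in> tower_submodule f c n"
proof (rule tower.act_closed[OF _ _ _ _ assms(2)])
  fix g and \<phi> :: "nat \<Rightarrow> nat \<Rightarrow> complex poly"
  assume \<phi>: "\<phi> \<in> tower_submodule f c n"
  have "tower_divisor f c n (Suc i) dvd \<phi> i k \<circ>\<^sub>p f" for i k
  proof -
    have "tower_divisor f c n i dvd \<phi> i k" using \<phi> by (simp add: tower_submodule_def)
    then obtain q where "\<phi> i k = tower_divisor f c n i * q" by (rule dvdE)
    then show ?thesis using tower_divisor_pcompose[OF c] by (simp add: pcompose_mult)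
  qed
  then show "tower_step f g \<phi> \<in> tower_submodule f c n"
    using \<phi> by (cases g) (auto simp: tower_submodule_def split: nat.split)
qed (auto simp: tower_submodule_def tower_scale_def intro: dvd_smult)

definition tower_unit :: "nat \<Rightarrow> nat \<Rightarrow> complex poly"
  where "tower_unit i k = (if i = 0 \<and> k = 0 then 1 else 0)"

text \<open>\<open>tower_unit\<close> stands for \<open>1\<close>. Without any power of
  \<open>y\<close> the correction term of \<open>x\<close> vanishes, so \<open>x\<^sup>n\<close>
  merely moves the entry to row \<open>n\<close>.\<close>

lemma act_tower_unit:
  "tower.act f tower_unit (var Gen_x ^ n * (var Gen_h - scalar c)) =
    (\<lambda>i k. if i = n \<and> k = 0 then [:- c, 1:] else 0)"
proof -
  have "(tower_step f Gen_x ^^ n) tower_unit = (\<lambda>i k. if i = n \<and> k = 0 then 1 else 0)"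
    by (induction n) (auto simp: fun_eq_iff tower_unit_def pcompose_1 split: nat.split)
  then show ?thesis
    by (auto simp: tower.act_mult tower.act_diff_right tower.act_var_power tower.act_var tower.act_scalar
        tower_scale_def fun_eq_iff iter_comp_simps one_pCons)
qed

section \<open>Fixed points and the strictly increasing chain\<close>

lemma fixed_point_exists:
  assumes "Polynomial.degree f \<noteq> 1"
  obtains c :: complex where "poly f c = c"
proof -
  have "Polynomial.degree (f - [:0, 1:]) \<noteq> 0"
  proof
    assume "Polynomial.degree (f - [:0, 1:]) = 0"
    then obtain d where "f - [:0, 1:] = [:d:]" by (rule degree_eq_zeroE)
    then have "f = [:d, 1:]" by (simp add: algebra_simps)
    with assms show False by simp
  qed
  then obtain c where "poly (f - [:0, 1:]) c = 0"
    using fundamental_theorem_of_algebra[of "f - [:0, 1:]"] by (auto simp: constant_degree)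
  then show thesis using that by simp
qed

text \<open>Divisibility of a linear polynomial forces degree at most one, hence a constant
  \<open>f\<close>. Then \<open>f\<close> equals its fixed point and the divisor is zero.\<close>

lemma not_fixed_point_dvd:
  assumes "Polynomial.degree f \<noteq> 1" "poly f c = (c::complex)"
  shows "\<not> f - [:c:] dvd [:- c, 1:]"
proof
  assume dvd: "f - [:c:] dvd [:- c, 1:]"
  have "Polynomial.degree f = Polynomial.degree ((f - [:c:]) + [:c:])" by simp
  also have "\<dots> \<le> max (Polynomial.degree (f - [:c:])) (Polynomial.degree [:c:])"
    by (rule degree_add_le_max)
  also have "\<dots> \<le> 1" using dvd_imp_degree_le[OF dvd] by simp
  finally have "Polynomial.degree f = 0" using assms(1) by simp
  then obtain d where "f = [:d:]" by (rule degree_eq_zeroE)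
  with assms(2) have "f - [:c:] = 0" by simp
  with dvd show False by simp
qed

lemma not_right_noetherian_over_heisenberg_ideal:
  assumes "Polynomial.degree f \<noteq> 1"
  shows "\<not> right_noetherian_over (heisenberg_ideal f) UNIV"
proof
  assume noetherian: "right_noetherian_over (heisenberg_ideal f) UNIV"
  obtain c where c: "poly f c = c" using fixed_point_exists[OF assms] .
  \<comment> \<open>Pulling the submodules back along the action on \<open>tower_unit\<close> gives
    right ideals of the free algebra that contain the Heisenberg ideal.\<close>
  define S where "S n = {a. tower.act f tower_unit a \<in> tower_submodule f c n}" for n
  have zero: "0 \<in> tower_submodule f c n"
    and diff: "u \<in> tower_submodule f c n \<Longrightarrow> v \<in> tower_submodule f c n \<Longrightarrow> u - v \<in> tower_submodule f c n"
    for n u v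
    by (auto simp: tower_submodule_def)
  have S: "right_ideal_in UNIV (S n)" for n
    using zero diff act_tower_submodule[OF c]
    by (auto simp: right_ideal_in_def S_def tower.act_zero_right tower.act_diff_right tower.act_mult)
  have "tower_divisor f c (Suc n) i dvd tower_divisor f c n i" for n i
    using fixed_point_dvd[OF c] by (auto simp: tower_divisor_def)
  then have "S n \<subseteq> S (Suc n)" for n
    unfolding S_def tower_submodule_def by (blast intro: dvd_trans)
  then have mono: "mono S" by (rule incseq_SucI)
  have I: "heisenberg_ideal f \<subseteq> S n" for n
    using zero by (auto simp: S_def tower_act_heisenberg_ideal)
  \<comment> \<open>Strictness of the chain: row \<open>Suc n\<close> requires the divisor
    \<open>f - c\<close> in \<open>S n\<close>, but only \<open>h - c\<close> in
    \<open>S (Suc n)\<close>.\<close>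
  have mem: "var Gen_x ^ m * (var Gen_h - scalar c) \<in> S n \<longleftrightarrow> m \<le> n" for m n
    using not_fixed_point_dvd[OF assms c]
    by (auto simp: S_def act_tower_unit tower_submodule_def tower_divisor_def)
  have "right_ideal_in UNIV (\<Union>n. S n)"
    unfolding right_ideal_in_def
  proof (intro conjI ballI)
    show "0 \<in> (\<Union>n. S n)" using right_ideal_inD(2)[OF S] by blast
    show "a * b \<in> (\<Union>n. S n)" if "a \<in> (\<Union>n. S n)" for a b
      using that right_ideal_inD(6)[OF S] by blast
    fix a b assume "a \<in> (\<Union>n. S n)" "b \<in> (\<Union>n. S n)"
    then obtain N where "{a, b} \<subseteq> S N" using finite_subset_chain[OF mono, of "{a, b}"] by auto
    then show "a - b \<in> (\<Union>n. S n)" using right_ideal_inD(5)[OF S[of N], of a b] by auto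
  qed simp
  moreover have "heisenberg_ideal f \<subseteq> (\<Union>n. S n)" using I by blast
  ultimately obtain G where G: "G \<subseteq> (\<Union>n. S n)" "finite G"
    "\<And>K. right_ideal_in UNIV K \<Longrightarrow> heisenberg_ideal f \<subseteq> K \<Longrightarrow> G \<subseteq> K \<Longrightarrow> (\<Union>n. S n) \<subseteq> K"
    using right_noetherian_overE[OF noetherian] by metis
  obtain N where "G \<subseteq> S N" using finite_subset_chain[OF mono G(2,1)] .
  then have "S (Suc N) \<subseteq> S N" using G(3)[OF S I] by blast
  then show False using mem[of "Suc N" "Suc N"] mem[of "Suc N" N] by auto
qed


section \<open>One-sided Noetherian rings and quotients\<close>

lemma gen_right_ideal_subset: "S \<subseteq> gen_right_ideal R S"
  by (auto simp: gen_right_ideal_def)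

lemma gen_right_ideal_eqI:
  assumes "right_ideal J R" "S \<subseteq> J" "\<And>K. right_ideal K R \<Longrightarrow> S \<subseteq> K \<Longrightarrow> J \<subseteq> K"
  shows "J = gen_right_ideal R S"
  using assms by (auto simp: gen_right_ideal_def)

lemma gen_right_ideal_minimal: "right_ideal K R \<Longrightarrow> S \<subseteq> K \<Longrightarrow> gen_right_ideal R S \<subseteq> K"
  by (auto simp: gen_right_ideal_def)

lemma (in ring_hom_ring) right_ideal_vimage:
  assumes "right_ideal J S"
  shows "right_ideal {a \<in> carrier R. h a \<in> J} R"
proof -
  interpret J: right_ideal J S by (rule assms)
  have minus: "\<ominus>\<^bsub>S\<^esub> b \<in> J" if "b \<in> J" for b
    using subgroup.m_inv_closed[OF J.a_subgroup that] unfolding a_inv_def .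
  have "additive_subgroup {a \<in> carrier R. h a \<in> J} R"
    by (intro additive_subgroupI R.add.subgroupI)
      (auto simp: minus J.zero_closed J.a_closed simp flip: a_inv_def intro!: exI[of _ "\<zero>"])
  then show ?thesis
    using J.I_r_closed by (auto simp: right_ideal_def right_ideal_axioms_def R.ring_axioms)
qed

lemma (in ring_hom_ring) right_ideal_image:
  assumes "right_ideal J R" and surj: "h ` carrier R = carrier S"
  shows "right_ideal (h ` J) S"
proof -
  interpret J: right_ideal J R by (rule assms(1))
  have "additive_subgroup (h ` J) S"
    by (intro additive_subgroupI img_is_add_subgroup J.a_subgroup)
  moreover have "h a \<otimes>\<^bsub>S\<^esub> y \<in> h ` J" if a: "a \<in> J" and y: "y \<in> carrier S" for a y
  proof -
    obtain b where b: "b \<in> carrier R" "y = h b" using y surj by blast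
    then have "h a \<otimes>\<^bsub>S\<^esub> y = h (a \<otimes> b)" using J.a_Hcarr[OF a] by simp
    then show ?thesis using J.I_r_closed[OF a b(1)] by simp
  qed
  ultimately show ?thesis
    by (auto simp: right_ideal_def right_ideal_axioms_def S.ring_axioms)
qed

lemma (in ring_hom_ring) right_noetherian_ring_image:
  assumes "right_noetherian_ring R" and surj: "h ` carrier R = carrier S"
  shows "right_noetherian_ring S"
proof
  fix J assume J: "right_ideal J S"
  interpret J: right_ideal J S by (rule J)
  let ?P = "{a \<in> carrier R. h a \<in> J}"
  obtain A where A: "A \<subseteq> carrier R" "finite A" "?P = gen_right_ideal R A"
    using right_noetherian_ring.right_finitely_gen[OF assms(1) right_ideal_vimage[OF J]] by blast
  have "J = gen_right_ideal S (h ` A)"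
  proof (rule gen_right_ideal_eqI[OF J])
    show "h ` A \<subseteq> J" using gen_right_ideal_subset[of A R] A(3) by blast
    fix K assume K: "right_ideal K S" "h ` A \<subseteq> K"
    have "?P \<subseteq> {a \<in> carrier R. h a \<in> K}"
      unfolding A(3) using A(1) K by (intro gen_right_ideal_minimal right_ideal_vimage) auto
    then have "h a \<in> K" if "a \<in> carrier R" "h a \<in> J" for a using that by blast
    moreover have "J \<subseteq> h ` carrier R" unfolding surj by (rule J.a_subset)
    ultimately show "J \<subseteq> K" by blast
  qed
  then show "\<exists>A\<subseteq>carrier S. finite A \<and> J = gen_right_ideal S A"
    using A(1,2) by (intro exI[of _ "h ` A"]) (auto simp flip: surj)
qed

text \<open>Right ideals of the quotient correspond to right ideals of the free algebra containing
  the ideal; finite generating sets are lifted and projected along the coset map.\<close>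

lemma right_noetherian_quotient_iff:
  "right_noetherian_ring (gen_heisenberg_algebra f) \<longleftrightarrow>
    right_noetherian_over (heisenberg_ideal f) UNIV"
proof -
  let ?I = "heisenberg_ideal f" and ?Q = "gen_heisenberg_algebra f"
  interpret I: ideal ?I free_alg_ring by (rule ideal_heisenberg_ideal)
  define h where "h = (\<lambda>a. ?I +>\<^bsub>free_alg_ring\<^esub> a)"
  have Q: "?Q = free_alg_ring Quot ?I" by (simp add: gen_heisenberg_algebra_def heisenberg_ideal_def)
  interpret h: ring_hom_ring free_alg_ring ?Q h
    unfolding Q h_def by (rule I.rcos_ring_hom_ring)
  have surj: "h ` carrier free_alg_ring = carrier ?Q"
    by (auto simp: Q h_def FactRing_def A_RCOSETS_def')
  have eq: "h a = h b \<longleftrightarrow> a - b \<in> ?I" for a b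
    using free_alg.quotient_eq_iff_same_a_r_cos[OF ideal_heisenberg_ideal, of a b f]
    by (simp add: h_def a_minus_def)
  show ?thesis
  proof
    assume "right_noetherian_ring ?Q"
    then interpret noetherian: right_noetherian_ring ?Q .
    show "right_noetherian_over ?I UNIV"
      unfolding right_noetherian_over_def
    proof (intro allI impI, elim conjE)
      fix J assume J: "right_ideal_in UNIV J" "?I \<subseteq> J"
      obtain A where A: "finite A" "h ` J = gen_right_ideal ?Q A"
        using noetherian.right_finitely_gen[OF h.right_ideal_image[OF _ surj]] J(1)
        unfolding right_ideal_free_alg_ring by blast
      then have "A \<subseteq> h ` J" using gen_right_ideal_subset by metis
      then obtain G where G: "G \<subseteq> J" "finite G" "A = h ` G"
        using finite_subset_image[OF A(1)] by metis
      have "J \<subseteq> K" if K: "right_ideal_in UNIV K" "?I \<subseteq> K" "G \<subseteq> K" for K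
      proof
        fix a assume "a \<in> J"
        have "h ` J \<subseteq> h ` K"
          unfolding A(2) using K G(3)
          by (intro gen_right_ideal_minimal h.right_ideal_image surj)
            (auto simp: right_ideal_free_alg_ring)
        then obtain k where "h a = h k" "k \<in> K" using \<open>a \<in> J\<close> by blast
        \<comment> \<open>Equal cosets differ by an element of the ideal, which lies in
          \<open>K\<close>.\<close>
        then have "(a - k) + k \<in> K" using K(2) right_ideal_inD(4)[OF K(1)] eq by blast
        then show "a \<in> K" by simp
      qed
      then show "\<exists>G\<subseteq>J. finite G \<and> (\<forall>K. right_ideal_in UNIV K \<and> ?I \<subseteq> K \<and> G \<subseteq> K \<longrightarrow> J \<subseteq> K)"
        using G(1,2) by blast
    qed
  next
    assume noetherian: "right_noetherian_over ?I UNIV"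
    show "right_noetherian_ring ?Q"
    proof
      fix J assume J: "right_ideal J ?Q"
      interpret J: right_ideal J ?Q by (rule J)
      have vimage: "right_ideal_in UNIV {a. h a \<in> K}" "?I \<subseteq> {a. h a \<in> K}" if "right_ideal K ?Q" for K
      proof -
        show K: "right_ideal_in UNIV {a. h a \<in> K}"
          using h.right_ideal_vimage[OF that] by (simp add: right_ideal_free_alg_ring)
        have "h a = h 0" if "a \<in> ?I" for a using that eq by simp
        then show "?I \<subseteq> {a. h a \<in> K}" using right_ideal_inD(2)[OF K] by auto
      qed
      obtain G where G: "G \<subseteq> {a. h a \<in> J}" "finite G"
        "\<And>K. right_ideal_in UNIV K \<Longrightarrow> ?I \<subseteq> K \<Longrightarrow> G \<subseteq> K \<Longrightarrow> {a. h a \<in> J} \<subseteq> K"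
        using right_noetherian_overE[OF noetherian vimage[OF J]] by metis
      have "J = gen_right_ideal ?Q (h ` G)"
      proof (rule gen_right_ideal_eqI[OF J])
        show "h ` G \<subseteq> J" using G(1) by blast
        fix K assume K: "right_ideal K ?Q" "h ` G \<subseteq> K"
        have "{a. h a \<in> J} \<subseteq> {a. h a \<in> K}" using K(2) by (intro G(3) vimage K(1)) auto
        moreover have "J \<subseteq> range h" using J.a_subset surj by simp
        ultimately show "J \<subseteq> K" by blast
      qed
      moreover have "h ` G \<subseteq> carrier ?Q" using surj by auto
      ultimately show "\<exists>A\<subseteq>carrier ?Q. finite A \<and> J = gen_right_ideal ?Q A"
        using G(2) by blast
    qed
  qed
qed


section \<open>Left--right symmetry\<close>

definition opp_ring :: "('a, 'b) ring_scheme \<Rightarrow> 'a ring"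
  where "opp_ring R = \<lparr>carrier = carrier R, mult = (\<lambda>a b. b \<otimes>\<^bsub>R\<^esub> a), one = \<one>\<^bsub>R\<^esub>,
    zero = \<zero>\<^bsub>R\<^esub>, add = (\<oplus>\<^bsub>R\<^esub>)\<rparr>"

lemma opp_ring_simps [simp]:
  "carrier (opp_ring R) = carrier R" "a \<otimes>\<^bsub>opp_ring R\<^esub> b = b \<otimes>\<^bsub>R\<^esub> a"
  "a \<oplus>\<^bsub>opp_ring R\<^esub> b = a \<oplus>\<^bsub>R\<^esub> b" "\<one>\<^bsub>opp_ring R\<^esub> = \<one>\<^bsub>R\<^esub>" "\<zero>\<^bsub>opp_ring R\<^esub> = \<zero>\<^bsub>R\<^esub>"
  by (simp_all add: opp_ring_def)

lemma (in ring) ring_opp_ring: "ring (opp_ring R)"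
proof (rule ringI)
  show "abelian_group (opp_ring R)"
  proof (rule abelian_groupI)
    fix a assume "a \<in> carrier (opp_ring R)"
    then show "\<exists>b\<in>carrier (opp_ring R). b \<oplus>\<^bsub>opp_ring R\<^esub> a = \<zero>\<^bsub>opp_ring R\<^esub>"
      by (intro bexI[of _ "\<ominus> a"]) (simp_all add: l_neg)
  qed (simp_all add: a_ac)
  show "Group.monoid (opp_ring R)"
    by (rule monoidI) (simp_all add: m_assoc)
qed (simp_all add: l_distr r_distr)

lemma (in ring) left_noetherian_iff_opp_ring:
  "left_noetherian_ring R \<longleftrightarrow> right_noetherian_ring (opp_ring R)"
proof -
  have ideals: "left_ideal J R \<longleftrightarrow> right_ideal J (opp_ring R)" for J
    using ring_axioms ring_opp_ring
    by (simp add: left_ideal_def left_ideal_axioms_def right_ideal_def right_ideal_axioms_def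
        additive_subgroup_def subgroup_def m_inv_def opp_ring_def)
  then have "gen_left_ideal R A = gen_right_ideal (opp_ring R) A" for A
    by (simp add: gen_left_ideal_def gen_right_ideal_def)
  with ideals show ?thesis
    using ring_axioms ring_opp_ring
    by (simp add: left_noetherian_ring_def left_noetherian_ring_axioms_def
        right_noetherian_ring_def right_noetherian_ring_axioms_def)
qed

section \<open>The anti-automorphism of the free algebra\<close>

fun swap_gen :: "gen \<Rightarrow> gen"
  where "swap_gen Gen_x = Gen_y" | "swap_gen Gen_y = Gen_x" | "swap_gen Gen_h = Gen_h"

definition swap_word :: "word \<Rightarrow> word"
  where "swap_word w = Word (rev (map swap_gen (letters w)))"

text \<open>This anti-automorphism exchanges the first two relations and fixes the third.\<close>

definition swap :: "free_alg \<Rightarrow> free_alg"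
  where "swap = Poly_Mapping.map_key swap_word"

lemma swap_gen_swap_gen [simp]: "swap_gen (swap_gen g) = g"
  by (cases g) simp_all

lemma swap_word_swap_word [simp]: "swap_word (swap_word w) = w"
  by (cases w) (simp add: swap_word_def rev_map comp_def)

lemma inj_swap_word: "inj swap_word"
  by (rule inj_on_inverseI[of _ swap_word]) simp

text \<open>\<open>map_key\<close> precomposes with \<open>swap_word\<close>, which would move keys
  by the inverse; \<open>swap_word\<close> is an involution, so the two agree.\<close>

lemma swap_single: "swap (Poly_Mapping.single w c) = Poly_Mapping.single (swap_word w) c"
  using map_key_single[OF inj_swap_word, of "swap_word w" c] by (simp add: swap_def)

lemma swap_add: "swap (a + b) = swap a + swap b"
  by (simp add: swap_def map_key_plus inj_swap_word)

lemma swap_zero: "swap 0 = 0"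
  by (simp add: swap_def inj_swap_word)

lemma swap_diff: "swap (a - b) = swap a - swap b"
  using swap_add[of "a - b" b] by (simp add: algebra_simps)

lemma swap_swap [simp]: "swap (swap a) = a"
  by (induction a rule: free_alg_induct) (simp_all add: swap_zero swap_add swap_single)

lemma swap_mult: "swap (a * b) = swap b * swap a"
proof (induction a rule: free_alg_induct)
  case zero
  show ?case by (simp add: swap_zero)
next
  case (add a w c)
  have "swap (Poly_Mapping.single w c * Poly_Mapping.single w' d) =
      swap (Poly_Mapping.single w' d) * swap (Poly_Mapping.single w c)" for w' d
    by (simp add: mult_single swap_single swap_word_def plus_word_def mult.commute)
  then have "swap (Poly_Mapping.single w c * b) = swap b * swap (Poly_Mapping.single w c)"
    by (induction b rule: free_alg_induct)
      (simp_all add: swap_zero swap_add distrib_left distrib_right)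
  with add show ?case by (simp add: swap_add distrib_left distrib_right)
qed

lemma swap_scalar: "swap (scalar c) = scalar c"
  by (simp add: scalar_def swap_single swap_word_def zero_word_def)

lemma swap_var: "swap (var g) = var (swap_gen g)"
  by (simp add: var_def swap_single swap_word_def)

lemma swap_one: "swap 1 = 1"
  using swap_scalar[of 1] by (simp add: scalar_simps)

lemma swap_sum: "swap (sum b S) = (\<Sum>i\<in>S. swap (b i))"
  by (induction S rule: infinite_finite_induct) (simp_all add: swap_zero swap_add)

lemma swap_poly_h: "swap (poly_h f) = poly_h f"
proof -
  have "swap (var Gen_h ^ n) = var Gen_h ^ n" for n
    by (induction n) (simp_all add: swap_one swap_mult swap_var power_commutes)
  then show ?thesis by (simp add: poly_h_def swap_sum swap_mult swap_scalar scalar_central)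
qed

text \<open>The preimage of the ideal under \<open>swap\<close> is a two-sided ideal containing the
  relations, which gives one inclusion. The other follows because \<open>swap\<close> is an
  involution.\<close>

lemma swap_heisenberg_ideal: "swap ` heisenberg_ideal f = heisenberg_ideal f"
proof -
  note I = right_ideal_inD(2,5,6)[OF right_ideal_heisenberg_ideal[of f]]
  have sub: "heisenberg_ideal f \<subseteq> {a. swap a \<in> heisenberg_ideal f}"
  proof (rule heisenberg_ideal_subset)
    show "right_ideal_in UNIV {a. swap a \<in> heisenberg_ideal f}"
      using I heisenberg_ideal_l_closed
      by (simp add: right_ideal_in_def swap_zero swap_diff swap_mult)
    show "b * a \<in> {a. swap a \<in> heisenberg_ideal f}" if "a \<in> {a. swap a \<in> heisenberg_ideal f}" for a b
      using that I(3) by (simp add: swap_mult)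
    show "heisenberg_relations f \<subseteq> {a. swap a \<in> heisenberg_ideal f}"
      using relations_subset_heisenberg_ideal[of f]
      by (auto simp: heisenberg_relations_def swap_diff swap_mult swap_var swap_poly_h)
  qed
  then have "a \<in> swap ` heisenberg_ideal f" if "a \<in> heisenberg_ideal f" for a
    using that by (intro image_eqI[of _ _ "swap a"]) auto
  with sub show ?thesis by blast
qed

text \<open>As \<open>swap\<close> preserves the ideal, it maps cosets to cosets and induces
  surjective homomorphisms between the quotient and its opposite in both directions. Left ideals of
  a ring are right ideals of its opposite.\<close>

lemma left_noetherian_iff_right_noetherian:
  "left_noetherian_ring (gen_heisenberg_algebra f) \<longleftrightarrow>
    right_noetherian_ring (gen_heisenberg_algebra f)"
proof -
  let ?I = "heisenberg_ideal f" and ?Q = "gen_heisenberg_algebra f"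
  interpret I: ideal ?I free_alg_ring by (rule ideal_heisenberg_ideal)
  have Q: "?Q = free_alg_ring Quot ?I" by (simp add: gen_heisenberg_algebra_def heisenberg_ideal_def)
  interpret Q: ring ?Q unfolding Q by (rule I.quotient_is_ring)
  define coset where "coset = (\<lambda>a. ?I +>\<^bsub>free_alg_ring\<^esub> a)"
  have carrier: "carrier ?Q = range coset"
    by (auto simp: Q coset_def FactRing_def A_RCOSETS_def')
  have coset: "coset a \<otimes>\<^bsub>?Q\<^esub> coset b = coset (a * b)" "coset a \<oplus>\<^bsub>?Q\<^esub> coset b = coset (a + b)"
    "\<one>\<^bsub>?Q\<^esub> = coset 1" for a b
    using ring_hom_mult[OF I.rcos_ring_hom, of a b] ring_hom_add[OF I.rcos_ring_hom, of a b]
      ring_hom_one[OF I.rcos_ring_hom]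
    by (simp_all add: Q coset_def)
  have swap: "swap ` coset a = coset (swap a)" for a
  proof -
    have "swap ` coset a = (\<lambda>i. i + swap a) ` (swap ` ?I)"
      by (auto simp: coset_def a_r_coset_def' swap_add image_iff)
    also have "\<dots> = coset (swap a)"
      unfolding swap_heisenberg_ideal by (auto simp: coset_def a_r_coset_def')
    finally show ?thesis .
  qed
  have surj: "(`) swap ` carrier ?Q = carrier ?Q"
  proof -
    have "(`) swap ` carrier ?Q = range (\<lambda>a. coset (swap a))" by (simp add: carrier image_image swap)
    also have "\<dots> = coset ` range swap" by (simp add: image_image)
    also have "range swap = UNIV" by (rule surjI[of _ swap]) simp
    finally show ?thesis by (simp add: carrier)
  qed
  \<comment> \<open>Elements of the quotient are cosets, that is sets, so the induced map is the
    image under \<open>swap\<close>.\<close>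
  have hom: "(`) swap \<in> ring_hom ?Q (opp_ring ?Q)" "(`) swap \<in> ring_hom (opp_ring ?Q) ?Q"
    by (auto intro!: ring_hom_memI simp: carrier coset swap swap_mult swap_add swap_one del: equalityI)
  have "right_noetherian_ring (opp_ring ?Q)" if "right_noetherian_ring ?Q"
  proof -
    interpret ring_hom_ring ?Q "opp_ring ?Q" "(`) swap"
      by (intro ring_hom_ringI2 Q.ring_axioms Q.ring_opp_ring hom)
    show ?thesis using right_noetherian_ring_image[OF that] surj by simp
  qed
  moreover have "right_noetherian_ring ?Q" if "right_noetherian_ring (opp_ring ?Q)"
  proof -
    interpret ring_hom_ring "opp_ring ?Q" ?Q "(`) swap"
      by (intro ring_hom_ringI2 Q.ring_axioms Q.ring_opp_ring hom)
    show ?thesis using right_noetherian_ring_image[OF that] surj by simp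
  qed
  ultimately show ?thesis using Q.left_noetherian_iff_opp_ring by blast
qed

theorem proposition2p4:
  fixes f :: "complex poly"
  shows "(right_noetherian_ring (gen_heisenberg_algebra f) \<longleftrightarrow> Polynomial.degree f = 1) \<and>
         (left_noetherian_ring (gen_heisenberg_algebra f) \<longleftrightarrow> Polynomial.degree f = 1)"
  unfolding left_noetherian_iff_right_noetherian right_noetherian_quotient_iff
  using right_noetherian_over_heisenberg_ideal not_right_noetherian_over_heisenberg_ideal by blast

end
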